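(* Let $q\ge 3$ be a prime power and let $X\subset\mathbb{P}^3(\mathbb{F}_q)$ be a hyperbolic quadric. The codewords of second weight of $C_2(X)$ correspond to the quadrics of the following types, i.e. a codeword of $C_2(X)$ has weight equal to the second weight if and only if it equals $c(f)$ for some form $f$ of degree 2 such that $Z(f)$ is one of the following: (1) a union of two distinct tangent planes to $X$ such that the line of intersection of the two planes is a generator of $X$; (2) a union of a tangent plane and a non-tangent plane to $X$ such that the line of intersection of the two planes is tangent to $X$; (3) a hyperbolic quadric containing exactly two generators of $X$, lying in distinct reguli, and such that the remaining $q$ lines of one regulus (of $Z(f)$) are all bisecants to $X$.
   Context: A quadric in $\mathbb{P}^3(\mathbb{F}_q)$ is the zero set $Z(f)$ of a nonzero form $f$ of degree 2 in $x_0,\dots,x_3$ over $\mathbb{F}_q$. It is non-degenerate if it has rank 4, the rank being the smallest number of indeterminates appearing in $f$ under any linear change of coordinates. A hyperbolic quadric is a non-degenerate quadric with $(q+1)^2$ points over $\mathbb{F}_q$. A regulus is the set of transversals of three pairwise skew lines in $\mathbb{P}^3(\mathbb{F}_q)$; it consists of $q+1$ pairwise skew lines. A hyperbolic quadric is a pair of complementary reguli $\mathcal{R}_1\cup\mathcal{R}_2$, each of which covers the quadric; the lines of these reguli are all the lines contained in it and are called its generators. A line is tangent to $X$ if it is not contained in $X$ and meets $X$ in exactly one point, and a bisecant to $X$ if it meets $X$ in exactly two points. A tangent plane to $X$ is a plane meeting $X$ in a degenerate plane quadric (two generators through a point); a non-tangent plane meets $X$ in a (non-degenerate) conic. Let $F$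 be the $\mathbb{F}_q$-vector space of forms of degree 2 in $x_0,\dots,x_3$ over $\mathbb{F}_q$ (including $0$). Each point $x\in\mathbb{P}^3(\mathbb{F}_q)$ is represented by its unique homogeneous coordinate vector whose first nonzero coordinate equals $1$. The functional code $C_2(X)$ is the image of the linear map $c:F\to\mathbb{F}_q^{|X|}$, $c(f)=(f(x_0,\dots,x_3))_{x\in X}$. The weight of a codeword is its number of nonzero coordinates. The second weight is the second smallest nonzero value taken by the weight. *)

theory Defs
  imports "HOL-Analysis.Cartesian_Space" "HOL-Library.FuncSet"
begin

text \<open>
  The form \<open>\<Sum>i\<le>j. a i j x\<^sub>i x\<^sub>j\<close> is represented by its upper triangular coefficient matrix.
  The index type \<open>4\<close> has the elements \<open>0 < 1 < 2 < 3\<close>, matching the indeterminates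
  \<open>x\<^sub>0, \<dots>, x\<^sub>3\<close>.
\<close>

definition forms2 :: "('a::field ^ 4 ^ 4) set"
  where "forms2 = {f. \<forall>i j. j < i \<longrightarrow> f $ i $ j = 0}"

definition form_eval :: "'a::field ^ 4 ^ 4 \<Rightarrow> 'a ^ 4 \<Rightarrow> 'a"
  where "form_eval f x = (\<Sum>i\<in>UNIV. \<Sum>j\<in>UNIV. f $ i $ j * x $ i * x $ j)"

text \<open>
  The change of coordinates \<open>x \<mapsto> A *v x\<close>: the product matrix below is in general not triangular,
  so the coefficients of \<open>x\<^sub>k x\<^sub>l\<close> and \<open>x\<^sub>l x\<^sub>k\<close> are collected.
\<close>

definition form_subst :: "'a::field ^ 4 ^ 4 \<Rightarrow> 'a ^ 4 ^ 4 \<Rightarrow> 'a ^ 4 ^ 4"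
  where "form_subst A f =
    (let B = transpose A ** f ** A
     in \<chi> k l. if k < l then B $ k $ l + B $ l $ k else if k = l then B $ k $ k else 0)"

definition form_indets :: "'a::field ^ 4 ^ 4 \<Rightarrow> 4 set"
  where "form_indets f = {k. \<exists>l. f $ k $ l \<noteq> 0 \<or> f $ l $ k \<noteq> 0}"

definition form_rank :: "'a::field ^ 4 ^ 4 \<Rightarrow> nat"
  where "form_rank f = (LEAST n. \<exists>A. invertible A \<and> card (form_indets (form_subst A f)) = n)"

text \<open>A point is its coordinate vector whose first nonzero coordinate is \<open>1\<close>.\<close>

definition points :: "('a::field ^ 4) set"
  where "points = {x. \<exists>i. x $ i = 1 \<and> (\<forall>j<i. x $ j = 0)}"

definition is_line :: "('a::field ^ 4) set \<Rightarrow> bool"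
  where "is_line l \<longleftrightarrow> (\<exists>S. vec.subspace S \<and> vec.dim S = 2 \<and> l = S \<inter> points)"

definition is_plane :: "('a::field ^ 4) set \<Rightarrow> bool"
  where "is_plane P \<longleftrightarrow> (\<exists>S. vec.subspace S \<and> vec.dim S = 3 \<and> P = S \<inter> points)"

definition zero_set :: "'a::field ^ 4 ^ 4 \<Rightarrow> ('a ^ 4) set"
  where "zero_set f = {x \<in> points. form_eval f x = 0}"

definition hyperbolic_quadric :: "('a::{field,finite} ^ 4) set \<Rightarrow> bool"
  where "hyperbolic_quadric X \<longleftrightarrow>
    (\<exists>f \<in> forms2. f \<noteq> 0 \<and> form_rank f = 4 \<and> X = zero_set f) \<and> card X = (CARD('a) + 1)\<^sup>2"

definition regulus :: "('a::field ^ 4) set set \<Rightarrow> bool"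
  where "regulus R \<longleftrightarrow>
    (\<exists>l1 l2 l3. is_line l1 \<and> is_line l2 \<and> is_line l3 \<and>
       l1 \<inter> l2 = {} \<and> l1 \<inter> l3 = {} \<and> l2 \<inter> l3 = {} \<and>
       R = {m. is_line m \<and> m \<inter> l1 \<noteq> {} \<and> m \<inter> l2 \<noteq> {} \<and> m \<inter> l3 \<noteq> {}})"

definition regulus_of :: "('a::field ^ 4) set \<Rightarrow> ('a ^ 4) set set \<Rightarrow> bool"
  where "regulus_of X R \<longleftrightarrow> regulus R \<and> \<Union>R = X"

definition generator :: "('a::field ^ 4) set \<Rightarrow> ('a ^ 4) set \<Rightarrow> bool"
  where "generator X l \<longleftrightarrow> is_line l \<and> l \<subseteq> X"

definition tangent_line :: "('a::field ^ 4) set \<Rightarrow> ('a ^ 4) set \<Rightarrow> bool"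
  where "tangent_line X l \<longleftrightarrow> is_line l \<and> \<not> l \<subseteq> X \<and> card (l \<inter> X) = 1"

definition bisecant :: "('a::field ^ 4) set \<Rightarrow> ('a ^ 4) set \<Rightarrow> bool"
  where "bisecant X l \<longleftrightarrow> is_line l \<and> card (l \<inter> X) = 2"

definition tangent_plane :: "('a::field ^ 4) set \<Rightarrow> ('a ^ 4) set \<Rightarrow> bool"
  where "tangent_plane X P \<longleftrightarrow> is_plane P \<and>
    (\<exists>g h p. generator X g \<and> generator X h \<and> g \<inter> h = {p} \<and> P \<inter> X = g \<union> h)"

definition non_tangent_plane :: "('a::field ^ 4) set \<Rightarrow> ('a ^ 4) set \<Rightarrow> bool"
  where "non_tangent_plane X P \<longleftrightarrow> is_plane P \<and> \<not> tangent_plane X P"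

text \<open>Codewords are functions on \<open>X\<close>, made extensional by \<^const>\<open>restrict\<close>.\<close>

definition codeword :: "('a::field ^ 4) set \<Rightarrow> 'a ^ 4 ^ 4 \<Rightarrow> 'a ^ 4 \<Rightarrow> 'a"
  where "codeword X f = (\<lambda>x\<in>X. form_eval f x)"

definition functional_code :: "('a::field ^ 4) set \<Rightarrow> ('a ^ 4 \<Rightarrow> 'a) set"
  where "functional_code X = codeword X ` forms2"

definition weight :: "('a::field ^ 4) set \<Rightarrow> ('a ^ 4 \<Rightarrow> 'a) \<Rightarrow> nat"
  where "weight X w = card {x \<in> X. w x \<noteq> 0}"

definition nonzero_weights :: "('a::field ^ 4) set \<Rightarrow> nat set"
  where "nonzero_weights X = weight X ` functional_code X - {0}"

definition second_weight :: "('a::field ^ 4) set \<Rightarrow> nat"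
  where "second_weight X = Min (nonzero_weights X - {Min (nonzero_weights X)})"

definition tangent_planes_through_generator ::
    "('a::field ^ 4) set \<Rightarrow> ('a ^ 4) set \<Rightarrow> bool"
  where "tangent_planes_through_generator X Y \<longleftrightarrow>
    (\<exists>P1 P2. tangent_plane X P1 \<and> tangent_plane X P2 \<and> P1 \<noteq> P2 \<and>
       generator X (P1 \<inter> P2) \<and> Y = P1 \<union> P2)"

definition tangent_and_non_tangent_plane ::
    "('a::field ^ 4) set \<Rightarrow> ('a ^ 4) set \<Rightarrow> bool"
  where "tangent_and_non_tangent_plane X Y \<longleftrightarrow>
    (\<exists>P1 P2. tangent_plane X P1 \<and> non_tangent_plane X P2 \<and>
       tangent_line X (P1 \<inter> P2) \<and> Y = P1 \<union> P2)"

definition hyperbolic_sharing_two_generators ::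
    "('a::{field,finite} ^ 4) set \<Rightarrow> ('a ^ 4) set \<Rightarrow> bool"
  where "hyperbolic_sharing_two_generators X Y \<longleftrightarrow> hyperbolic_quadric Y \<and>
    (\<exists>g1 g2. g1 \<noteq> g2 \<and> {g. generator X g \<and> g \<subseteq> Y} = {g1, g2} \<and>
       (\<exists>R1 R2. regulus_of X R1 \<and> regulus_of X R2 \<and> R1 \<noteq> R2 \<and> g1 \<in> R1 \<and> g2 \<in> R2) \<and>
       (\<exists>R. regulus_of Y R \<and> (\<forall>l \<in> R - {g1, g2}. bisecant X l)))"

end

theory Submission
  imports Defs "HOL-Computational_Algebra.Polynomial"
begin

text \<open>
  A hyperbolic quadric \<open>X\<close> is, in suitable coordinates, the Segre variety \<open>y\<^sub>0 y\<^sub>3 = y\<^sub>1 y\<^sub>2\<close>,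
  parametrised by a pair of points of the projective line; a quadratic form restricts to a form of
  bidegree \<open>(2, 2)\<close>. If such a form has more than \<open>2q + 2\<close> zeros, then it has at least three, hence
  only, zeros on some line of each ruling. Moving these two lines to \<open>y\<^sub>0 = 0\<close> shows that on \<open>X\<close>
  the form is \<open>y\<^sub>0\<close> times a linear form, i.e. the codeword comes from a tangent plane and another
  plane. Counting zeros in the affine chart \<open>y\<^sub>0 = 1\<close> gives the weights \<open>(q - 1)\<^sup>2\<close>, \<open>q\<^sup>2 - q\<close>
  and larger ones, so the second weight belongs to the forms with exactly \<open>3q + 1\<close> zeros on \<open>X\<close>.
  Inclusion-exclusion for the two planes then yields types (1) and (2), and conversely each of the
  three types has \<open>3q + 1\<close> zeros on \<open>X\<close>. In particular every codeword of type (3) is also one of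
  type (1) or (2).
\<close>

text \<open>The equation of \<open>X\<close> vanishes on \<open>X\<close>, so adding a multiple of
  it to a form leaves the codeword unchanged. A form with irreducible zero set may therefore share
  its codeword with a product of two linear forms, and choosing the representative well is the point
  of the argument. The bound \<open>2q + 2\<close> is two zeros on each of the \<open>q + 1\<close>
  lines of a ruling; three zeros on a line force a binary quadratic form to vanish there. A form
  with at most \<open>2q + 2\<close> zeros has weight at least \<open>q^2 - 1\<close>, which exceeds
  \<open>q^2 - q\<close>. Vanishing on one line of each ruling makes the form of bidegree
  \<open>(2, 2)\<close> divisible by a linear factor in each parameter. With both lines at infinity
  these factors multiply to the coordinate \<open>y0\<close>, and the cofactor of bidegree
  \<open>(1, 1)\<close> is linear in the four coordinates. The characteristic is arbitrary, so
  orthogonality is expressed by the polar form, without halving.\<close>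

lemma UNIV_index: "(UNIV :: 4 set) = {0, 1, 2, 3}"
proof -
  have "(4 :: 4) = 0"
    by simp
  then show ?thesis
    unfolding UNIV_4 by auto
qed

lemma sum_index: "(\<Sum>i\<in>(UNIV :: 4 set). f i) = f 0 + f 1 + f 2 + f 3"
  unfolding UNIV_index by (simp add: ac_simps)

lemma all_index: "(\<forall>i::4. P i) \<longleftrightarrow> P 0 \<and> P 1 \<and> P 2 \<and> P 3"
  using UNIV_index by (metis UNIV_I empty_iff insert_iff)

lemma less_index [simp]:
  "(0::4) < 1" "(0::4) < 2" "(0::4) < 3" "(1::4) < 2" "(1::4) < 3" "(2::4) < 3"
  "\<not> (1::4) < 0" "\<not> (2::4) < 0" "\<not> (3::4) < 0" "\<not> (2::4) < 1" "\<not> (3::4) < 1" "\<not> (3::4) < 2"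
  by (simp_all add: less_bit0_def bit0.Rep_numeral bit0.Rep_0 bit0.Rep_1)

section \<open>Vectors, quadratic forms and linear forms in four coordinates\<close>

definition vec4 :: "'a \<Rightarrow> 'a \<Rightarrow> 'a \<Rightarrow> 'a \<Rightarrow> 'a ^ 4"
  where "vec4 a b c d = (\<chi> i. if i = 0 then a else if i = 1 then b else if i = 2 then c else d)"

lemma vec4_nth [simp]:
  "vec4 a b c d $ 0 = a" "vec4 a b c d $ 1 = b" "vec4 a b c d $ 2 = c" "vec4 a b c d $ 3 = d"
  by (simp_all add: vec4_def)

lemma vec4_eq_iff: "x = y \<longleftrightarrow> x $ 0 = y $ 0 \<and> x $ 1 = y $ 1 \<and> x $ 2 = y $ 2 \<and> x $ 3 = y $ 3"
  for x y :: "'a ^ 4"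
  by (simp add: vec_eq_iff all_index)

lemma mat_vec4:
  fixes A :: "'a::semiring_1 ^ 4 ^ 4"
  shows "(A *v x) $ i = A $ i $ 0 * x $ 0 + A $ i $ 1 * x $ 1 + A $ i $ 2 * x $ 2 + A $ i $ 3 * x $ 3"
  by (simp add: matrix_vector_mult_def sum_index)

lemma form_eval_expand:
  assumes "f \<in> forms2"
  shows "form_eval f x =
    f $ 0 $ 0 * x $ 0 * x $ 0 + f $ 0 $ 1 * x $ 0 * x $ 1 + f $ 0 $ 2 * x $ 0 * x $ 2 + f $ 0 $ 3 * x $ 0 * x $ 3 +
    f $ 1 $ 1 * x $ 1 * x $ 1 + f $ 1 $ 2 * x $ 1 * x $ 2 + f $ 1 $ 3 * x $ 1 * x $ 3 +
    f $ 2 $ 2 * x $ 2 * x $ 2 + f $ 2 $ 3 * x $ 2 * x $ 3 + f $ 3 $ 3 * x $ 3 * x $ 3"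
  using assms by (simp add: form_eval_def sum_index forms2_def all_index)

lemma form_subst_forms2: "form_subst A f \<in> forms2"
  by (auto simp add: form_subst_def forms2_def Let_def)

lemma form_eval_dot: "form_eval f x = (\<Sum>i\<in>UNIV. x $ i * (f *v x) $ i)"
  by (simp add: form_eval_def matrix_vector_mult_def sum_distrib_left algebra_simps)

lemma sum_mat_vec_transpose: "(\<Sum>i\<in>UNIV. (A *v x) $ i * y $ i) = (\<Sum>i\<in>UNIV. x $ i * (transpose A *v y) $ i)"
  for A :: "'a::field ^ 4 ^ 4"
  by (simp add: mat_vec4 sum_index transpose_def algebra_simps)

text \<open>As \<open>form_eval\<close> is a dot product of \<open>x\<close> with
  \<open>f *v x\<close>, the substitution passes to the matrix through a transpose. Folding that
  matrix into its upper triangle changes no value.\<close>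

lemma form_eval_subst: "form_eval (form_subst A f) x = form_eval f (A *v x)"
proof -
  have "form_eval f (A *v x) = form_eval (transpose A ** f ** A) x"
    unfolding form_eval_dot sum_mat_vec_transpose
    by (simp flip: matrix_vector_mul_assoc)
  also have "\<dots> = form_eval (form_subst A f) x"
    by (simp add: form_eval_def form_subst_def Let_def sum_index algebra_simps)
  finally show ?thesis ..
qed

lemma form_eval_scale: "form_eval f (c *s x) = c\<^sup>2 * form_eval f x"
  by (simp add: form_eval_def power2_eq_square sum_distrib_left algebra_simps)

text \<open>Coefficients of a product of two linear forms, whose zero set is a pair of planes; off
  the diagonal both mixed terms fall on the same monomial.\<close>

definition product_form :: "'a::field ^ 4 \<Rightarrow> 'a ^ 4 \<Rightarrow> 'a ^ 4 ^ 4"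
  where "product_form a b =
    (\<chi> i j. if i < j then a $ i * b $ j + a $ j * b $ i else if i = j then a $ i * b $ i else 0)"

definition dot :: "'a::field ^ 4 \<Rightarrow> 'a ^ 4 \<Rightarrow> 'a"
  where "dot a x = a $ 0 * x $ 0 + a $ 1 * x $ 1 + a $ 2 * x $ 2 + a $ 3 * x $ 3"

lemma dot_add: "dot a (x + y) = dot a x + dot a y"
  and dot_scale: "dot a (c *s x) = c * dot a x"
  and dot_diff: "dot a (x - y) = dot a x - dot a y"
  and dot_zero [simp]: "dot a 0 = 0"
  by (simp_all add: dot_def algebra_simps)

lemma dot_mat: "dot m (A *v x) = dot (transpose A *v m) x"
  by (simp add: dot_def mat_vec4 transpose_def algebra_simps)

lemma product_form_forms2: "product_form a b \<in> forms2"
  by (auto simp add: product_form_def forms2_def)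

lemma form_eval_product: "form_eval (product_form a b) x = dot a x * dot b x"
  by (simp add: form_eval_def product_form_def sum_index dot_def algebra_simps)

section \<open>Normalised representatives of projective points\<close>

definition leading_index :: "'a::zero ^ 4 \<Rightarrow> 4"
  where "leading_index x = (LEAST i. x $ i \<noteq> 0)"

text \<open>The vector \<open>0\<close> represents no point; there \<open>rep\<close> has the value \<open>0\<close>.\<close>

definition rep :: "'a::field ^ 4 \<Rightarrow> 'a ^ 4"
  where "rep x = inverse (x $ leading_index x) *s x"

lemma leading_index:
  assumes "x \<noteq> 0"
  shows "x $ leading_index x \<noteq> 0" "j < leading_index x \<Longrightarrow> x $ j = 0"
proof -
  obtain i where "x $ i \<noteq> 0"
    using assms by (auto simp: vec_eq_iff)
  then show "x $ leading_index x \<noteq> 0"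
    unfolding leading_index_def by (rule LeastI)
  show "x $ j = 0" if "j < leading_index x"
    using that not_less_Least unfolding leading_index_def by blast
qed

lemma rep_in_points: "x \<noteq> 0 \<Longrightarrow> rep x \<in> points"
  unfolding points_def rep_def using leading_index [of x] by (auto intro!: exI [of _ "leading_index x"])

lemma rep_scale: "x \<noteq> 0 \<Longrightarrow> \<exists>c. c \<noteq> 0 \<and> rep x = c *s x"
  unfolding rep_def using leading_index(1) by (intro exI conjI) auto

lemma points_nonzero: "x \<in> points \<Longrightarrow> x \<noteq> 0"
  by (auto simp: points_def)

text \<open>Proportional vectors have their first nonzero entry at the same index; both entries
  being 1, the factor is 1. Projective points can thus be compared as vectors.\<close>

lemma points_unique:
  assumes "x \<in> points" "y \<in> points" "x = c *s y"
  shows "x = y"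
proof -
  obtain i where i: "x $ i = 1" "\<And>j. j < i \<Longrightarrow> x $ j = 0"
    using assms(1) by (auto simp: points_def)
  obtain j where j: "y $ j = 1" "\<And>k. k < j \<Longrightarrow> y $ k = 0"
    using assms(2) by (auto simp: points_def)
  have "c \<noteq> 0"
    using assms(1,3) points_nonzero by fastforce
  then have "i = j"
    using i j assms(3) by (metis linorder_neqE mult_eq_0_iff vector_smult_component zero_neq_one)
  then have "c = 1"
    using i j assms(3) by simp
  then show ?thesis
    using assms(3) by simp
qed

lemma rep_eqI:
  assumes "x \<in> points" "x = c *s y"
  shows "rep y = x"
proof -
  have "y \<noteq> 0"
    using assms points_nonzero by fastforce
  then obtain d where d: "rep y = d *s y"
    using rep_scale by blast
  have "c \<noteq> 0"
    using assms points_nonzero by fastforce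
  then have "rep y = (d * inverse c) *s x"
    using assms(2) d by simp
  then show ?thesis
    using points_unique rep_in_points \<open>y \<noteq> 0\<close> assms(1) by blast
qed

lemma rep_eq_iff:
  assumes "x \<noteq> 0" "y \<noteq> 0"
  shows "rep x = rep y \<longleftrightarrow> (\<exists>c. c \<noteq> 0 \<and> x = c *s y)"
proof
  assume eq: "rep x = rep y"
  obtain c d where "c \<noteq> 0" "d \<noteq> 0" "rep x = c *s x" "rep y = d *s y"
    using rep_scale assms by metis
  then show "\<exists>c. c \<noteq> 0 \<and> x = c *s y"
    using eq by (intro exI [of _ "inverse c * d"]) (metis divide_inverse_commute field_class.field_inverse
        mult_eq_0_iff inverse_nonzero_iff_nonzero vector_smult_assoc vec.scale_one)
next
  assume "\<exists>c. c \<noteq> 0 \<and> x = c *s y"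
  then obtain c where c: "c \<noteq> 0" "x = c *s y" by blast
  obtain d where "rep x = d *s x"
    using rep_scale assms by metis
  then have "rep x = (d * c) *s y"
    using c by simp
  then show "rep x = rep y"
    using rep_eqI [OF rep_in_points [OF assms(1)]] by metis
qed

lemma rep_subspace_iff:
  assumes "x \<noteq> 0" "vec.subspace S"
  shows "rep x \<in> S \<longleftrightarrow> x \<in> S"
proof -
  obtain c where c: "c \<noteq> 0" "rep x = c *s x"
    using rep_scale assms by metis
  then have "x = inverse c *s rep x"
    by simp
  then show ?thesis
    using c assms(2) by (metis vec.subspace_scale)
qed

section \<open>Lines and planes\<close>

lemma subspace_hyperplane: "vec.subspace {x. dot a x = 0}"
  by (auto simp: vec.subspace_def dot_add dot_scale)

lemma dot_axis: "dot a (vec4 1 0 0 0) = a $ 0" "dot a (vec4 0 1 0 0) = a $ 1"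
  "dot a (vec4 0 0 1 0) = a $ 2" "dot a (vec4 0 0 0 1) = a $ 3"
  by (simp_all add: dot_def)

lemma dim_UNIV_4: "vec.dim (UNIV :: ('a::field ^ 4) set) = 4"
  by (simp add: card_cart_basis)

lemma dim_hyperplane:
  fixes a :: "'a::field ^ 4"
  assumes "a \<noteq> 0"
  shows "vec.dim {x. dot a x = 0} = 3"
proof -
  let ?S = "{x. dot a x = 0}"
  obtain v where v: "dot a v \<noteq> 0"
    using assms dot_axis [of a] by (metis vec4_eq_iff zero_index)
  have span: "vec.span ?S = ?S"
    by (simp add: subspace_hyperplane vec.span_eq_iff)
  have "x \<in> vec.span (insert v ?S)" for x
    unfolding vec.span_breakdown_eq span
    using v by (intro exI [of _ "dot a x / dot a v"]) (simp add: dot_diff dot_scale)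
  then have "vec.span (insert v ?S) = UNIV"
    by blast
  then have "vec.dim (insert v ?S) = 4"
    by (metis dim_UNIV_4 vec.dim_span)
  then show ?thesis
    using v by (simp add: vec.dim_insert span)
qed

text \<open>A vector \<open>v\<close> outside \<open>S\<close> completes it to the whole space, so
  each \<open>x\<close> has a unique coefficient \<open>\<phi> x\<close> with
  \<open>x - \<phi> x *s v\<close> in \<open>S\<close>. Uniqueness makes \<open>\<phi>\<close>
  linear with kernel \<open>S\<close>; its values on the unit vectors are the coefficients of the
  equation.\<close>

lemma hyperplane_equation:
  fixes S :: "('a::field ^ 4) set"
  assumes "vec.subspace S" "vec.dim S = 3"
  obtains a where "a \<noteq> 0" "S = {x. dot a x = 0}"
proof -
  have span: "vec.span S = S"
    using assms(1) by (simp add: vec.span_eq_iff)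
  have "S \<noteq> UNIV"
    using assms(2) dim_UNIV_4 [where 'a = 'a] by auto
  then obtain v where v: "v \<notin> S" by blast
  then have "vec.dim (insert v S) = 4"
    using assms(2) by (simp add: vec.dim_insert span)
  then have "vec.span (insert v S) = UNIV"
    using vec.dim_eq_full [of "insert v S"] by (simp add: card_cart_basis vec.dimension_def)
  then have "\<exists>k. x - k *s v \<in> S" for x
    using vec.span_breakdown_eq [of x v S] by (simp add: span)
  then obtain \<phi> where \<phi>: "\<And>x. x - \<phi> x *s v \<in> S"
    by metis
  have uniq: "k = \<phi> x" if "x - k *s v \<in> S" for k x
  proof (rule ccontr)
    assume ne: "k \<noteq> \<phi> x"
    have "(x - \<phi> x *s v) - (x - k *s v) \<in> S"
      by (rule vec.subspace_diff [OF assms(1) \<phi> that])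
    then have "(k - \<phi> x) *s v \<in> S"
      by (simp add: vec.scale_left_diff_distrib)
    then have "inverse (k - \<phi> x) *s ((k - \<phi> x) *s v) \<in> S"
      using assms(1) by (rule vec.subspace_scale [rotated])
    then show False
      using v ne by simp
  qed
  have add: "\<phi> (x + y) = \<phi> x + \<phi> y" for x y
  proof -
    have "(x - \<phi> x *s v) + (y - \<phi> y *s v) \<in> S"
      by (rule vec.subspace_add [OF assms(1) \<phi> \<phi>])
    then have "(x + y) - (\<phi> x + \<phi> y) *s v \<in> S"
      by (simp add: vec.scale_left_distrib algebra_simps)
    then show ?thesis
      using uniq by metis
  qed
  have scale: "\<phi> (c *s x) = c * \<phi> x" for c x
  proof -
    have "c *s (x - \<phi> x *s v) \<in> S"
      by (rule vec.subspace_scale [OF assms(1) \<phi>])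
    then have "c *s x - (c * \<phi> x) *s v \<in> S"
      by (simp add: vec.scale_right_diff_distrib)
    then show ?thesis
      using uniq by metis
  qed
  define a where "a = vec4 (\<phi> (vec4 1 0 0 0)) (\<phi> (vec4 0 1 0 0)) (\<phi> (vec4 0 0 1 0)) (\<phi> (vec4 0 0 0 1))"
  have dot: "dot a x = \<phi> x" for x
  proof -
    have "x = x $ 0 *s vec4 1 0 0 0 + x $ 1 *s vec4 0 1 0 0 + x $ 2 *s vec4 0 0 1 0 + x $ 3 *s vec4 0 0 0 1"
      by (simp add: vec4_eq_iff)
    then have "\<phi> x = x $ 0 * \<phi> (vec4 1 0 0 0) + x $ 1 * \<phi> (vec4 0 1 0 0) + x $ 2 * \<phi> (vec4 0 0 1 0) + x $ 3 * \<phi> (vec4 0 0 0 1)"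
      by (metis add scale)
    then show ?thesis
      by (simp add: a_def dot_def algebra_simps)
  qed
  have "x \<in> S \<longleftrightarrow> \<phi> x = 0" for x
    using \<phi> [of x] uniq [of x 0] by (metis diff_zero vec.scale_zero_left)
  then have S: "S = {x. dot a x = 0}"
    by (auto simp: dot)
  moreover have "a \<noteq> 0"
    using v S by (auto simp: dot_def)
  ultimately show thesis
    using that by blast
qed

lemma dim_add_le_4:
  fixes S T :: "('a::field ^ 4) set"
  shows "vec.dim {x + y |x y. x \<in> S \<and> y \<in> T} \<le> 4"
  using vec.dim_subset_UNIV [of "{x + y |x y. x \<in> S \<and> y \<in> T}"] by (simp add: vec.dimension_def vec_dim_card card_cart_basis)

lemma distinct_hyperplanes_meet:
  fixes S T :: "('a::field ^ 4) set"
  assumes "vec.subspace S" "vec.dim S = 3" "vec.subspace T" "vec.dim T = 3" "S \<noteq> T"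
  shows "vec.dim (S \<inter> T) = 2"
proof -
  let ?U = "{x + y |x y. x \<in> S \<and> y \<in> T}"
  have sum: "vec.dim ?U + vec.dim (S \<inter> T) = 6"
    using vec.dim_sums_Int [OF assms(1,3)] assms by simp
  have "\<not> S \<subseteq> T"
    using vec.subspace_dim_equal [OF assms(1,3)] assms by auto
  then have "S \<inter> T \<subset> S"
    by blast
  then have "vec.dim (S \<inter> T) < 3"
    using assms vec.dim_psubset [of "S \<inter> T" S]
    by (metis vec.span_eq_iff vec.subspace_inter)
  then show ?thesis
    using sum dim_add_le_4 [of S T] by linarith
qed

text \<open>The ambient space \<open>H\<close> is left arbitrary so that the dimension formula can
  be applied inside a plane, where two lines always meet.\<close>

lemma subspaces_meet:
  fixes S T H :: "('a::field ^ 4) set"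
  assumes "vec.subspace S" "vec.subspace T" "vec.subspace H" "S \<subseteq> H" "T \<subseteq> H"
    and "vec.dim H < vec.dim S + vec.dim T"
  obtains x where "x \<in> S \<inter> T" "x \<noteq> 0"
proof -
  let ?U = "{x + y |x y. x \<in> S \<and> y \<in> T}"
  have "?U \<subseteq> H"
    using assms by (auto intro!: vec.subspace_add)
  then have "vec.dim ?U \<le> vec.dim H"
    by (rule vec.dim_subset)
  then have "vec.dim (S \<inter> T) \<noteq> 0"
    using vec.dim_sums_Int [OF assms(1,2)] assms(6) by linarith
  then have "\<not> S \<inter> T \<subseteq> {0}"
    by simp
  then show thesis
    using that by blast
qed

text \<open>Same normalisation as in \<open>points\<close>: one pair for each ratio, with
  \<open>(0, 1)\<close> at infinity and the pairs \<open>(1, u)\<close> as affine chart.\<close>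

definition proj_line :: "('a::field \<times> 'a) set"
  where "proj_line = insert (0, 1) (range (Pair 1))"

lemma card_proj_line: "card (proj_line :: ('a::{field,finite} \<times> 'a) set) = CARD('a) + 1"
proof -
  have "card (range (Pair (1::'a)) :: ('a \<times> 'a) set) = CARD('a)"
    by (simp add: card_image inj_on_def)
  moreover have "(0, 1) \<notin> (range (Pair 1) :: ('a \<times> 'a) set)"
    by auto
  ultimately show ?thesis
    by (simp add: proj_line_def)
qed

lemma proj_line_cases:
  assumes "s \<in> proj_line"
  obtains "s = (0, 1)" | u where "s = (1, u)"
  using assms by (auto simp: proj_line_def)

lemma proj_line_nonzero: "s \<in> proj_line \<Longrightarrow> fst s \<noteq> 0 \<or> snd s \<noteq> 0"
  by (auto simp: proj_line_def)

lemma proj_line_unique: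
  assumes "s \<in> proj_line" "t \<in> proj_line" "fst s * snd t = snd s * fst t"
  shows "s = t"
  using assms by (auto simp: proj_line_def)

lemma proj_line_exists:
  assumes "a \<noteq> 0 \<or> b \<noteq> 0"
  obtains s c where "s \<in> proj_line" "c \<noteq> 0" "a = c * fst s" "b = c * snd s"
proof (cases "a = 0")
  case True
  then show thesis
    using assms that [of "(0, 1)" b] by (simp add: proj_line_def)
next
  case False
  then show thesis
    using that [of "(1, b / a)" a] by (simp add: proj_line_def)
qed

lemma span_pair: "vec.span {a, b} = {c *s a + d *s b | c d. True}" for a b :: "'a::field ^ 4"
  by (force simp: vec.span_breakdown_eq diff_eq_eq add.commute)

lemma is_line_basis:
  assumes "is_line l"
  obtains a b where "\<And>c d. c *s a + d *s b = 0 \<longleftrightarrow> c = 0 \<and> d = 0"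
    and "l = {c *s a + d *s b | c d. True} \<inter> points"
proof -
  obtain S where S: "vec.subspace S" "vec.dim S = 2" "l = S \<inter> points"
    using assms by (auto simp: is_line_def)
  obtain B where B: "B \<subseteq> S" "vec.independent B" "S \<subseteq> vec.span B" "card B = 2"
    using vec.basis_exists [of S] S(2) by metis
  then obtain a b where ab: "B = {a, b}" "a \<noteq> b"
    by (meson card_2_iff)
  have "vec.span B = S"
    using B S(1) by (simp add: vec.span_subspace)
  moreover have "vec.span B = {c *s a + d *s b | c d. True}"
    by (simp add: ab span_pair)
  moreover have "c = 0 \<and> d = 0" if "c *s a + d *s b = 0" for c d
  proof -
    have "a \<notin> vec.span {b}" "b \<notin> vec.span {}"
      using B(2) ab by (auto simp: vec.independent_insert)
    have "c = 0"
    proof (rule ccontr)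
      assume "c \<noteq> 0"
      then have "a = (- d / c) *s b"
        using that by (metis add_eq_0_iff2 divide_inverse minus_divide_left mult.commute
          vec.scale_minus_left vec.scale_one left_inverse vec.scale_scale)
      then show False
        using \<open>a \<notin> vec.span {b}\<close> by (metis vec.span_base vec.span_scale singletonI)
    qed
    then show ?thesis
      using that \<open>b \<notin> vec.span {}\<close> by auto
  qed
  ultimately show thesis
    using that [of a b] S(3) by (smt (verit) add_0 vec.scale_zero_left)
qed

lemma is_lineI:
  assumes "\<And>c d. c *s a + d *s b = 0 \<Longrightarrow> c = 0 \<and> d = 0"
    and "l = {c *s a + d *s b | c d. True} \<inter> points"
  shows "is_line l"
proof -
  have ab: "a \<notin> vec.span {b}" "b \<noteq> 0"
  proof
    assume "a \<in> vec.span {b}"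
    then obtain k where "a = k *s b"
      by (auto simp: vec.span_breakdown_eq)
    then have "1 *s a + (- k) *s b = 0"
      by simp
    then show False
      using assms(1) by (metis zero_neq_one)
  next
    show "b \<noteq> 0"
      using assms(1) [of 0 1] by auto
  qed
  then have "vec.independent {a, b}"
    by (simp add: vec.independent_insert)
  moreover have "a \<noteq> b"
    using ab by (metis singletonI vec.span_base)
  ultimately have "vec.dim (vec.span {a, b}) = 2"
    by (simp add: vec.dim_span vec.dim_eq_card_independent)
  then show ?thesis
    unfolding is_line_def using assms(2) vec.subspace_span span_pair [of a b] by metis
qed

text \<open>Normalised coefficient pairs select one vector from each class of proportional nonzero
  combinations, so a line has as many points as the projective line.\<close>

lemma bij_betw_span_points:
  fixes a b :: "'a::field ^ 4"
  assumes ind: "\<And>c d. c *s a + d *s b = 0 \<Longrightarrow> c = 0 \<and> d = 0"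
  shows "bij_betw (\<lambda>s. rep (fst s *s a + snd s *s b)) proj_line ({c *s a + d *s b | c d. True} \<inter> points)"
proof -
  have nz: "fst s *s a + snd s *s b \<noteq> 0" if "s \<in> proj_line" for s
    using that proj_line_nonzero ind by metis
  show ?thesis
  proof (rule bij_betwI')
    fix s t :: "'a \<times> 'a"
    assume st: "s \<in> proj_line" "t \<in> proj_line"
    show "(rep (fst s *s a + snd s *s b) = rep (fst t *s a + snd t *s b)) = (s = t)"
    proof
      assume "rep (fst s *s a + snd s *s b) = rep (fst t *s a + snd t *s b)"
      then obtain c where "fst s *s a + snd s *s b = c *s (fst t *s a + snd t *s b)"
        using rep_eq_iff nz st by metis
      then have "(fst s - c * fst t) *s a + (snd s - c * snd t) *s b = 0"
        by (simp add: vec.scale_left_diff_distrib vec.scale_right_distrib algebra_simps)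
      then have "fst s = c * fst t" "snd s = c * snd t"
        using ind by (metis right_minus_eq)+
      then show "s = t"
        using proj_line_unique st by (metis mult.assoc mult.commute)
    qed auto
  next
    fix s :: "'a \<times> 'a" assume s: "s \<in> proj_line"
    obtain c where "rep (fst s *s a + snd s *s b) = c *s (fst s *s a + snd s *s b)"
      using rep_scale nz s by metis
    then have "rep (fst s *s a + snd s *s b) = (c * fst s) *s a + (c * snd s) *s b"
      by (simp add: vec.scale_right_distrib)
    then show "rep (fst s *s a + snd s *s b) \<in> {c *s a + d *s b |c d. True} \<inter> points"
      using rep_in_points nz s by blast
  next
    fix x assume x: "x \<in> {c *s a + d *s b |c d. True} \<inter> points"
    then obtain c d where cd: "x = c *s a + d *s b" by blast
    then have "c \<noteq> 0 \<or> d \<noteq> 0"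
      using x points_nonzero by fastforce
    then obtain s k where s: "s \<in> proj_line" "c = k * fst s" "d = k * snd s"
      using proj_line_exists by metis
    then have "x = k *s (fst s *s a + snd s *s b)"
      using cd by (simp add: vec.scale_right_distrib)
    then show "\<exists>s\<in>proj_line. x = rep (fst s *s a + snd s *s b)"
      using s(1) x by (intro bexI [of _ s] rep_eqI [symmetric]) auto
  qed
qed

lemma card_is_line:
  fixes l :: "('a::{field,finite} ^ 4) set"
  assumes "is_line l"
  shows "card l = CARD('a) + 1"
proof -
  obtain a b where "\<And>c d. c *s a + d *s b = 0 \<longleftrightarrow> c = 0 \<and> d = 0"
    and l: "l = {c *s a + d *s b | c d. True} \<inter> points"
    using is_line_basis [OF assms] by blast
  then show ?thesis
    using bij_betw_same_card [OF bij_betw_span_points [of a b]] card_proj_line by metis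
qed

lemma is_line_eqI:
  fixes l m :: "('a::{field,finite} ^ 4) set"
  assumes "is_line l" "is_line m" "l \<subseteq> m"
  shows "l = m"
  using assms card_is_line by (metis card_subset_eq finite)

section \<open>The Segre parametrisation\<close>

text \<open>The determinant of the 2 x 2 matrix with rows \<open>(y0, y1)\<close> and
  \<open>(y2, y3)\<close>. Its nonzero zeros are the matrices of rank one, which
  \<open>segre\<close> writes as a column times a row.\<close>

definition hyp :: "'a::field ^ 4 \<Rightarrow> 'a"
  where "hyp y = y $ 0 * y $ 3 - y $ 1 * y $ 2"

definition segre :: "'a::field \<times> 'a \<Rightarrow> 'a \<times> 'a \<Rightarrow> 'a ^ 4"
  where "segre s t = vec4 (fst s * fst t) (fst s * snd t) (snd s * fst t) (snd s * snd t)"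

lemma hyp_segre [simp]: "hyp (segre s t) = 0"
  by (simp add: hyp_def segre_def)

lemma hyp_scale: "hyp (c *s y) = c\<^sup>2 * hyp y"
  by (simp add: hyp_def power2_eq_square algebra_simps)

text \<open>Only the mixed term survives, as the product of the determinants of the two parameter
  pairs. Points differing in both parameters therefore span a line that leaves the quadric.\<close>

lemma hyp_add_segre:
  "hyp (c *s segre s t + d *s segre s' t') =
    c * d * (fst s * snd s' - snd s * fst s') * (fst t * snd t' - snd t * fst t')"
  by (simp add: hyp_def segre_def algebra_simps)

lemma segre_nonzero:
  assumes "s \<in> proj_line" "t \<in> proj_line"
  shows "segre s t \<noteq> 0"
  using assms [THEN proj_line_nonzero] by (auto simp: segre_def vec4_eq_iff)

lemma segre_inj:
  assumes "s \<in> proj_line" "t \<in> proj_line" "s' \<in> proj_line" "t' \<in> proj_line"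
    and eq: "segre s t = c *s segre s' t'" and "c \<noteq> 0"
  shows "s = s' \<and> t = t'"
proof -
  have eqs: "fst s * fst t = c * (fst s' * fst t')" "fst s * snd t = c * (fst s' * snd t')"
    "snd s * fst t = c * (snd s' * fst t')" "snd s * snd t = c * (snd s' * snd t')"
    using eq by (simp_all add: segre_def vec4_eq_iff)
  show ?thesis
    using assms(1-4,6) eqs by (auto simp: proj_line_def)
qed

text \<open>A nonzero singular 2 x 2 matrix has rank one; the factors are read off from the first
  nonzero entry of the first row, or from the second row if the first is zero.\<close>

lemma segre_surj:
  assumes "hyp y = 0" "y \<noteq> 0"
  obtains s t c where "s \<in> proj_line" "t \<in> proj_line" "c \<noteq> 0" "y = c *s segre s t"
proof -
  have y: "y $ 0 * y $ 3 = y $ 1 * y $ 2"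
    using assms(1) by (simp add: hyp_def)
  consider "y $ 0 \<noteq> 0" | "y $ 0 = 0" "y $ 1 \<noteq> 0" | "y $ 0 = 0" "y $ 1 = 0"
    by blast
  then show thesis
  proof cases
    case 1
    then have "y = y $ 0 *s segre (1, y $ 2 / y $ 0) (1, y $ 1 / y $ 0)"
      using y by (simp add: segre_def vec4_eq_iff field_simps)
    then show thesis
      using 1 that [of "(1, y $ 2 / y $ 0)" "(1, y $ 1 / y $ 0)" "y $ 0"] by (auto simp: proj_line_def)
  next
    case 2
    then have "y = y $ 1 *s segre (1, y $ 3 / y $ 1) (0, 1)"
      using y by (simp add: segre_def vec4_eq_iff field_simps)
    then show thesis
      using 2 that [of "(1, y $ 3 / y $ 1)" "(0, 1)" "y $ 1"] by (auto simp: proj_line_def)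
  next
    case 3
    then have "y $ 2 \<noteq> 0 \<or> y $ 3 \<noteq> 0"
      using assms(2) by (auto simp: vec4_eq_iff)
    then obtain t c where t: "t \<in> proj_line" "c \<noteq> 0" "y $ 2 = c * fst t" "y $ 3 = c * snd t"
      using proj_line_exists by metis
    then have "y = c *s segre (0, 1) t"
      using 3 by (simp add: segre_def vec4_eq_iff)
    then show thesis
      using t that [of "(0, 1)" t c] by (auto simp: proj_line_def)
  qed
qed

text \<open>\<open>X\<close> is a parameter next to the coordinate change \<open>A\<close> and its
  inverse \<open>A'\<close>, so one quadric can be read in several frames and all results of the
  locale hold again once its lines have been moved.\<close>

locale frame =
  fixes A A' :: "'a::{field,finite} ^ 4 ^ 4" and X :: "('a ^ 4) set"
  assumes inverse: "A ** A' = mat 1" "A' ** A = mat 1"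
    and X_eq: "X = {x \<in> points. hyp (A *v x) = 0}"
begin

lemma inverse_apply [simp]: "A *v (A' *v y) = y" "A' *v (A *v x) = x"
  using inverse by (simp_all add: matrix_vector_mul_assoc)

lemma A'_eq_0_iff [simp]: "A' *v y = 0 \<longleftrightarrow> y = 0"
  by (metis inverse_apply(1) matrix_vector_mult_0_right)

lemma A_eq_0_iff [simp]: "A *v y = 0 \<longleftrightarrow> y = 0"
  by (metis inverse_apply(2) matrix_vector_mult_0_right)

definition pt :: "'a \<times> 'a \<Rightarrow> 'a \<times> 'a \<Rightarrow> 'a ^ 4"
  where "pt s t = rep (A' *v segre s t)"

lemma pt_scale:
  assumes "s \<in> proj_line" "t \<in> proj_line"
  obtains c where "c \<noteq> 0" "pt s t = c *s (A' *v segre s t)"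
  using rep_scale [of "A' *v segre s t"] segre_nonzero [OF assms] unfolding pt_def by auto

lemma A_pt_scale:
  assumes "s \<in> proj_line" "t \<in> proj_line"
  obtains c where "c \<noteq> 0" "A *v pt s t = c *s segre s t"
  using pt_scale [OF assms] by (metis inverse_apply(1) vec.scale)

lemma pt_in_points: "\<lbrakk>s \<in> proj_line; t \<in> proj_line\<rbrakk> \<Longrightarrow> pt s t \<in> points"
  unfolding pt_def by (simp add: rep_in_points segre_nonzero)

lemma pt_in_X: "\<lbrakk>s \<in> proj_line; t \<in> proj_line\<rbrakk> \<Longrightarrow> pt s t \<in> X"
  unfolding X_eq using A_pt_scale pt_in_points
  by (metis (mono_tags, lifting) hyp_scale hyp_segre mem_Collect_eq mult_zero_right)

lemma pt_inj:
  assumes "s \<in> proj_line" "t \<in> proj_line" "s' \<in> proj_line" "t' \<in> proj_line"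
  shows "pt s t = pt s' t' \<longleftrightarrow> s = s' \<and> t = t'"
proof
  assume "pt s t = pt s' t'"
  then obtain c where "c \<noteq> 0" "A' *v segre s t = c *s (A' *v segre s' t')"
    unfolding pt_def using rep_eq_iff segre_nonzero assms by (metis A'_eq_0_iff)
  then have "segre s t = c *s segre s' t'"
    by (metis inverse_apply(1) vec.scale)
  then show "s = s' \<and> t = t'"
    using segre_inj assms \<open>c \<noteq> 0\<close> by blast
qed auto

lemma pt_surj:
  assumes "x \<in> X"
  obtains s t where "s \<in> proj_line" "t \<in> proj_line" "x = pt s t"
proof -
  have x: "x \<in> points" "hyp (A *v x) = 0"
    using assms X_eq by auto
  then obtain s t c where st: "s \<in> proj_line" "t \<in> proj_line" "c \<noteq> 0" "A *v x = c *s segre s t"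
    using segre_surj points_nonzero by (metis A_eq_0_iff)
  then have "x = c *s (A' *v segre s t)"
    by (metis inverse_apply(2) vec.scale)
  then show thesis
    using that st(1,2) x(1) rep_eqI unfolding pt_def by metis
qed

lemma bij_pt: "bij_betw (\<lambda>(s, t). pt s t) (proj_line \<times> proj_line) X"
  unfolding bij_betw_def inj_on_def using pt_inj pt_in_X by (auto elim!: pt_surj)

lemma card_pt:
  "card {x \<in> X. P x} = card {(s, t) \<in> proj_line \<times> proj_line. P (pt s t)}"
proof -
  have "bij_betw (\<lambda>(s, t). pt s t) {(s, t) \<in> proj_line \<times> proj_line. P (pt s t)} {x \<in> X. P x}"
    using bij_pt unfolding bij_betw_def by (auto simp: inj_on_def)
  from bij_betw_same_card [OF this] show ?thesis
    by simp
qed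

lemma card_X: "card X = (CARD('a) + 1)\<^sup>2"
  using bij_betw_same_card [OF bij_pt] by (simp add: card_cartesian_product card_proj_line power2_eq_square)

lemma form_eval_pt_eq_0_iff:
  assumes "s \<in> proj_line" "t \<in> proj_line"
  shows "form_eval f (pt s t) = 0 \<longleftrightarrow> form_eval f (A' *v segre s t) = 0"
  using pt_scale [OF assms] by (metis form_eval_scale mult_eq_0_iff power_eq_0_iff)

lemma dot_pt_eq_0_iff:
  assumes "s \<in> proj_line" "t \<in> proj_line"
  shows "dot m (A *v pt s t) = 0 \<longleftrightarrow> dot m (segre s t) = 0"
  using A_pt_scale [OF assms] by (metis dot_scale mult_eq_0_iff)

definition s_line :: "'a \<times> 'a \<Rightarrow> ('a ^ 4) set"
  where "s_line s = pt s ` proj_line"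

definition t_line :: "'a \<times> 'a \<Rightarrow> ('a ^ 4) set"
  where "t_line t = (\<lambda>s. pt s t) ` proj_line"

lemma is_line_s_line:
  assumes "s \<in> proj_line"
  shows "is_line (s_line s)"
proof -
  let ?a = "A' *v segre s (1, 0)" and ?b = "A' *v segre s (0, 1)"
  have comb: "c *s ?a + d *s ?b = A' *v segre s (c, d)" for c d
    by (simp add: segre_def vec4_eq_iff mat_vec4 algebra_simps)
  have ind: "c = 0 \<and> d = 0" if "c *s ?a + d *s ?b = 0" for c d
    using that proj_line_nonzero [OF assms] unfolding comb A'_eq_0_iff
    by (auto simp: segre_def vec4_eq_iff)
  have "s_line s = {c *s ?a + d *s ?b | c d. True} \<inter> points"
    using bij_betw_span_points [of ?a ?b] ind
    unfolding bij_betw_def s_line_def pt_def comb by simp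
  then show ?thesis
    using is_lineI ind by blast
qed

lemma is_line_t_line:
  assumes "t \<in> proj_line"
  shows "is_line (t_line t)"
proof -
  let ?a = "A' *v segre (1, 0) t" and ?b = "A' *v segre (0, 1) t"
  have comb: "c *s ?a + d *s ?b = A' *v segre (c, d) t" for c d
    by (simp add: segre_def vec4_eq_iff mat_vec4 algebra_simps)
  have ind: "c = 0 \<and> d = 0" if "c *s ?a + d *s ?b = 0" for c d
    using that proj_line_nonzero [OF assms] unfolding comb A'_eq_0_iff
    by (auto simp: segre_def vec4_eq_iff)
  have "t_line t = {c *s ?a + d *s ?b | c d. True} \<inter> points"
    using bij_betw_span_points [of ?a ?b] ind
    unfolding bij_betw_def t_line_def pt_def comb by simp
  then show ?thesis
    using is_lineI ind by blast
qed

lemma s_line_subset: "s \<in> proj_line \<Longrightarrow> s_line s \<subseteq> X"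
  and t_line_subset: "t \<in> proj_line \<Longrightarrow> t_line t \<subseteq> X"
  by (auto simp: s_line_def t_line_def pt_in_X)

lemma s_line_inter_t_line:
  assumes "s \<in> proj_line" "t \<in> proj_line"
  shows "s_line s \<inter> t_line t = {pt s t}"
  using assms by (auto simp: s_line_def t_line_def pt_inj)

text \<open>If both parameters differed, the sum of the two vectors would have nonzero
  \<open>hyp\<close> by \<open>hyp_add_segre\<close> and yield a point of the line off the
  quadric.\<close>

lemma line_in_X_shares_parameter:
  assumes l: "is_line l" "l \<subseteq> X"
    and st: "s \<in> proj_line" "t \<in> proj_line" "s' \<in> proj_line" "t' \<in> proj_line"
    and "pt s t \<in> l" "pt s' t' \<in> l"
  shows "s = s' \<or> t = t'"
proof (rule ccontr)
  assume ne: "\<not> (s = s' \<or> t = t')"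
  obtain S where S: "vec.subspace S" "l = S \<inter> points"
    using l(1) by (auto simp: is_line_def)
  let ?z = "pt s t + pt s' t'"
  obtain c where c: "c \<noteq> 0" "A *v pt s t = c *s segre s t"
    using A_pt_scale st by metis
  obtain d where d: "d \<noteq> 0" "A *v pt s' t' = d *s segre s' t'"
    using A_pt_scale st by metis
  have "hyp (A *v ?z) \<noteq> 0"
    using c d ne proj_line_unique [of s s'] proj_line_unique [of t t'] st
    by (auto simp: matrix_vector_right_distrib hyp_add_segre)
  moreover have "?z \<in> S"
    using S assms by (auto intro: vec.subspace_add)
  moreover have "?z \<noteq> 0"
    using \<open>hyp (A *v ?z) \<noteq> 0\<close> by (auto simp: hyp_def)
  ultimately have "rep ?z \<in> X"
    using S l(2) rep_in_points rep_subspace_iff by blast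
  moreover obtain k where "k \<noteq> 0" "rep ?z = k *s ?z"
    using rep_scale \<open>?z \<noteq> 0\<close> by blast
  ultimately show False
    using \<open>hyp (A *v ?z) \<noteq> 0\<close> by (simp add: X_eq vec.scale hyp_scale)
qed

text \<open>Two points of the line agree in exactly one parameter. A further point must share a
  parameter with each of them, which only the common one allows; equality then follows since all
  lines have the same number of points.\<close>

lemma lines_in_X:
  assumes l: "is_line l" "l \<subseteq> X"
  shows "(\<exists>s\<in>proj_line. l = s_line s) \<or> (\<exists>t\<in>proj_line. l = t_line t)"
proof -
  have "2 \<le> card l"
    using card_is_line [OF l(1)] by (simp add: Suc_le_eq zero_less_card_finite)
  then obtain x y where xy: "x \<in> l" "y \<in> l" "x \<noteq> y"
    by (metis card_2_iff' card_le_Suc0_iff_eq finite not_less_eq_eq numeral_2_eq_2)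
  obtain s t where st: "s \<in> proj_line" "t \<in> proj_line" "x = pt s t"
    using pt_surj xy l(2) by blast
  obtain s' t' where st': "s' \<in> proj_line" "t' \<in> proj_line" "y = pt s' t'"
    using pt_surj xy l(2) by blast
  have share: "s = s' \<or> t = t'"
    using line_in_X_shares_parameter l xy st st' by blast
  show ?thesis
  proof (cases "s = s'")
    case True
    then have "t \<noteq> t'"
      using xy(3) st st' by auto
    have "l \<subseteq> s_line s"
    proof
      fix z assume "z \<in> l"
      moreover obtain s'' t'' where z: "s'' \<in> proj_line" "t'' \<in> proj_line" "z = pt s'' t''"
        using pt_surj \<open>z \<in> l\<close> l(2) by blast
      ultimately have "s'' = s \<or> t'' = t" "s'' = s' \<or> t'' = t'"
        using line_in_X_shares_parameter l xy st st' by blast+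
      then have "s'' = s"
        using True \<open>t \<noteq> t'\<close> by blast
      then show "z \<in> s_line s"
        using z by (auto simp: s_line_def)
    qed
    then show ?thesis
      using is_line_eqI l(1) is_line_s_line st(1) by blast
  next
    case False
    then have "t = t'"
      using share by blast
    have "l \<subseteq> t_line t"
    proof
      fix z assume "z \<in> l"
      moreover obtain s'' t'' where z: "s'' \<in> proj_line" "t'' \<in> proj_line" "z = pt s'' t''"
        using pt_surj \<open>z \<in> l\<close> l(2) by blast
      ultimately have "s'' = s \<or> t'' = t" "s'' = s' \<or> t'' = t'"
        using line_in_X_shares_parameter l xy st st' by blast+
      then have "t'' = t"
        using False \<open>t = t'\<close> by blast
      then show "z \<in> t_line t"
        using z by (auto simp: t_line_def)
    qed
    then show ?thesis
      using is_line_eqI l(1) is_line_t_line st(2) by blast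
  qed
qed

end

lemma dot_zero_left [simp]: "dot 0 x = 0"
  by (simp add: dot_def)

lemma dot_eq_0D:
  assumes "\<And>x. dot a x = 0"
  shows "a = 0"
  unfolding vec4_eq_iff using dot_axis [of a, unfolded assms] by simp

section \<open>Plane sections and zeros of quadratic forms\<close>

lemma linear_zero_on_proj_line:
  fixes a b :: "'a::field"
  assumes "a \<noteq> 0 \<or> b \<noteq> 0"
  obtains t0 where "t0 \<in> proj_line"
    "\<And>t. t \<in> proj_line \<Longrightarrow> a * fst t + b * snd t = 0 \<longleftrightarrow> t = t0"
proof (cases "b = 0")
  case True
  then have "a * fst t + b * snd t = 0 \<longleftrightarrow> t = (0, 1)" if "t \<in> proj_line" for t
    using that assms by (auto simp: proj_line_def)
  then show thesis
    using that [of "(0, 1)"] by (simp add: proj_line_def)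
next
  case False
  then have "a * fst t + b * snd t = 0 \<longleftrightarrow> t = (1, - a / b)" if "t \<in> proj_line" for t
    using that by (auto simp: proj_line_def field_simps add_eq_0_iff)
  then show thesis
    using that [of "(1, - a / b)"] by (simp add: proj_line_def)
qed

text \<open>In the chart \<open>(1, v)\<close> the form is a polynomial of degree at most 2. The
  point at infinity is a zero only if \<open>c = 0\<close>, and then the degree drops by one, so a
  nonzero form never has three zeros.\<close>

lemma quadratic_zero_on_proj_line:
  fixes a b c :: "'a::{field,finite}"
  assumes "card {t \<in> proj_line. a * (fst t)\<^sup>2 + b * (fst t * snd t) + c * (snd t)\<^sup>2 = 0} > 2"
  shows "a = 0 \<and> b = 0 \<and> c = 0"
proof (rule ccontr)
  assume ne: "\<not> (a = 0 \<and> b = 0 \<and> c = 0)"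
  let ?p = "[:a, b, c:]"
  let ?Z = "{t \<in> proj_line. a * (fst t)\<^sup>2 + b * (fst t * snd t) + c * (snd t)\<^sup>2 = 0}"
  have "?p \<noteq> 0"
    using ne by simp
  have roots: "card {v. poly ?p v = 0} \<le> degree ?p"
    by (rule card_poly_roots_bound) fact
  have Z: "?Z = (if c = 0 then {(0, 1)} else {}) \<union> Pair 1 ` {v. poly ?p v = 0}"
    by (auto simp: proj_line_def image_iff power2_eq_square algebra_simps)
  have "card (Pair (1::'a) ` {v. poly ?p v = 0}) = card {v. poly ?p v = 0}"
    by (simp add: card_image inj_on_def)
  then have "card ?Z \<le> (if c = 0 then 1 else 0) + degree ?p"
    unfolding Z using roots by (intro order_trans [OF card_Un_le] add_mono) auto
  also have "\<dots> \<le> 2"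
    by (auto simp: degree_pCons_eq_if)
  finally show False
    using assms by simp
qed

lemma card_tangent_plane_inter:
  fixes X :: "('a::{field,finite} ^ 4) set"
  assumes "tangent_plane X P"
  shows "card (P \<inter> X) = 2 * CARD('a) + 1"
proof -
  obtain g h p where gh: "is_line g" "is_line h" "g \<inter> h = {p}" "P \<inter> X = g \<union> h"
    using assms by (auto simp: tangent_plane_def generator_def)
  have "card (g \<union> h) + card (g \<inter> h) = card g + card h"
    by (rule card_Un_Int [symmetric]) auto
  then show ?thesis
    using gh by (simp add: card_is_line)
qed

lemma card_matching_le:
  fixes P :: "'a::finite \<Rightarrow> 'b::finite \<Rightarrow> bool"
  assumes "\<And>u v v'. P u v \<Longrightarrow> P u v' \<Longrightarrow> v = v'"
  shows "card {(u, v). P u v} \<le> CARD('a)"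
proof -
  have "inj_on fst {(u, v). P u v}"
    using assms by (auto simp: inj_on_def)
  then show ?thesis
    by (rule card_inj_on_le) auto
qed

text \<open>By \<open>weight_product\<close> this counts the points of the quadric off both planes
  \<open>y0 = 0\<close> and \<open>dot m y = 0\<close>. The value \<open>(q - 1)^2\<close> arises
  when the second plane cuts the chart in two crossing generators; in all other cases there are at
  most \<open>q\<close> zeros.\<close>

lemma card_bilinear_nonzero:
  fixes m :: "'a::{field,finite} ^ 4"
  assumes "m \<noteq> 0"
  defines "W \<equiv> card {(u, v). m $ 0 + m $ 1 * v + m $ 2 * u + m $ 3 * (u * v) \<noteq> 0}"
  shows "W = (CARD('a) - 1)\<^sup>2 \<or> W \<ge> CARD('a) * (CARD('a) - 1)"
proof -
  let ?h = "\<lambda>u v. m $ 0 + m $ 1 * v + m $ 2 * u + m $ 3 * (u * v)"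
  let ?q = "CARD('a)"
  have W: "W + card {(u, v). ?h u v = 0} = ?q * ?q"
  proof -
    have "{(u, v). ?h u v \<noteq> 0} \<inter> {(u, v). ?h u v = 0} = {}"
      by auto
    then have "W + card {(u, v). ?h u v = 0} = card ({(u, v). ?h u v \<noteq> 0} \<union> {(u, v). ?h u v = 0})"
      unfolding W_def by (simp add: card_Un_disjoint)
    also have "{(u, v). ?h u v \<noteq> 0} \<union> {(u, v). ?h u v = 0} = UNIV"
      by auto
    finally show ?thesis
      by simp
  qed
  have few: ?thesis if "card {(u, v). ?h u v = 0} \<le> ?q"
  proof -
    have "?q * (?q - 1) = ?q * ?q - ?q"
      by (simp add: diff_mult_distrib2)
    then show ?thesis
      using W that by linarith
  qed
  show ?thesis
  proof (cases "m $ 3 = 0")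
    case False
    \<comment> \<open>Completing the product: \<open>k\<close> is \<open>hyp m\<close>, so it
      vanishes exactly when the polynomial splits into a factor in \<open>u\<close> and a factor in
      \<open>v\<close>.\<close>
    define k where "k = m $ 0 * m $ 3 - m $ 1 * m $ 2"
    have h: "m $ 3 * ?h u v = (m $ 3 * u + m $ 1) * (m $ 3 * v + m $ 2) + k" for u v
      by (simp add: k_def algebra_simps)
    show ?thesis
    proof (cases "k = 0")
      case True
      have "?h u v \<noteq> 0 \<longleftrightarrow> u \<noteq> - m $ 1 / m $ 3 \<and> v \<noteq> - m $ 2 / m $ 3" for u v
      proof -
        have "?h u v \<noteq> 0 \<longleftrightarrow> m $ 3 * u + m $ 1 \<noteq> 0 \<and> m $ 3 * v + m $ 2 \<noteq> 0"
        proof -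
          have "m $ 3 * ?h u v = (m $ 3 * u + m $ 1) * (m $ 3 * v + m $ 2)"
            using h [where u = u and v = v] unfolding True add_0_right .
          then show ?thesis
            using False by (metis mult_eq_0_iff)
        qed
        then show ?thesis
          using False by (simp add: field_simps eq_neg_iff_add_eq_0)
      qed
      then have "{(u, v). ?h u v \<noteq> 0} = (UNIV - {- m $ 1 / m $ 3}) \<times> (UNIV - {- m $ 2 / m $ 3})"
        by auto
      then have "W = (?q - 1) * (?q - 1)"
        unfolding W_def by (simp add: card_cartesian_product card_Diff_singleton)
      then show ?thesis
        by (simp add: power2_eq_square)
    next
      case k: False
      have "card {(u, v). ?h u v = 0} \<le> ?q"
      proof (rule card_matching_le)
        fix u v v' assume "?h u v = 0" "?h u v' = 0"
        then have "(m $ 3 * u + m $ 1) * (m $ 3 * v + m $ 2) = - k"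
          "(m $ 3 * u + m $ 1) * (m $ 3 * v' + m $ 2) = - k"
          using h [where u = u and v = v] h [where u = u and v = v'] by (simp_all add: eq_neg_iff_add_eq_0)
        then have "(m $ 3 * u + m $ 1) * (m $ 3 * v + m $ 2) = (m $ 3 * u + m $ 1) * (m $ 3 * v' + m $ 2)"
          "m $ 3 * u + m $ 1 \<noteq> 0"
          using k by auto
        then show "v = v'"
          using False by simp
      qed
      then show ?thesis
        by (rule few)
    qed
  next
    case m3: True
    show ?thesis
    proof (cases "m $ 1 = 0")
      case False
      have "card {(u, v). ?h u v = 0} \<le> ?q"
      proof (rule card_matching_le)
        fix u v v' assume "?h u v = 0" "?h u v' = 0"
        then have "?h u v = ?h u v'"
          by simp
        then show "v = v'"
          using m3 False by simp
      qed
      then show ?thesis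
        by (rule few)
    next
      case m1: True
      show ?thesis
      proof (cases "m $ 2 = 0")
        case True
        then have "?h u v \<noteq> 0" for u v
          using m3 m1 assms(1) by (simp add: vec4_eq_iff)
        then have "card {(u, v). ?h u v = 0} \<le> ?q"
          by simp
        then show ?thesis
          by (rule few)
      next
        case False
        \<comment> \<open>Here \<open>v\<close> is free and \<open>u\<close> is fixed, so
          \<open>card_matching_le\<close> does not apply; the zeros form one affine line.\<close>
        have "{(u, v). ?h u v = 0} \<subseteq> {- m $ 0 / m $ 2} \<times> UNIV"
        proof (rule subsetI)
          fix z assume "z \<in> {(u, v). ?h u v = 0}"
          then obtain u v where z: "z = (u, v)" "?h u v = 0"
            by blast
          then have "u * m $ 2 = - m $ 0"
            using m1 m3 by (simp add: eq_neg_iff_add_eq_0 add.commute mult.commute)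
          then show "z \<in> {- m $ 0 / m $ 2} \<times> UNIV"
            using nonzero_eq_divide_eq [OF False, of u "- m $ 0"] z(1) by blast
        qed
        then have "card {(u, v). ?h u v = 0} \<le> card ({- m $ 0 / m $ 2} \<times> (UNIV :: 'a set))"
          by (intro card_mono) auto
        then show ?thesis
          by (intro few) simp
      qed
    qed
  qed
qed

section \<open>Plane sections of the quadric\<close>

context frame
begin

lemma hyperplane_pullback:
  fixes a :: "'a ^ 4"
  assumes "a \<noteq> 0"
  obtains m where "m \<noteq> 0" "\<And>x. dot a x = dot m (A *v x)"
proof -
  have "dot (transpose A' *v a) (A *v x) = dot a x" for x
    by (metis dot_mat inverse_apply(2))
  moreover from this have "transpose A' *v a \<noteq> 0"
    using assms by (metis dot_zero_left dot_eq_0D)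
  ultimately show thesis
    using that by metis
qed

lemma is_plane_dot:
  assumes "m \<noteq> 0"
  shows "is_plane {x \<in> points. dot m (A *v x) = 0}"
proof -
  have eq: "dot m (A *v x) = dot (transpose A *v m) x" for x
    by (rule dot_mat)
  have "transpose A *v m \<noteq> 0"
  proof
    assume "transpose A *v m = 0"
    then have "dot m y = 0" for y
      using eq [of "A' *v y"] by simp
    then show False
      using assms dot_eq_0D by blast
  qed
  then show ?thesis
    unfolding is_plane_def eq
    by (intro exI [of _ "{x. dot (transpose A *v m) x = 0}"])
      (auto simp: subspace_hyperplane dim_hyperplane)
qed

lemma dot_segre:
  "dot m (segre s t) =
    (m $ 0 * fst s + m $ 2 * snd s) * fst t + (m $ 1 * fst s + m $ 3 * snd s) * snd t"
  by (simp add: dot_def segre_def algebra_simps)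

text \<open>With \<open>hyp m = 0\<close> the coefficient vector is itself a multiple of a Segre
  point, so on the quadric the equation of the plane is a linear form in \<open>s\<close> times a
  linear form in \<open>t\<close>. Each factor has one zero, and these give the two
  generators.\<close>

lemma tangent_plane_dot:
  assumes "m \<noteq> 0" "hyp m = 0"
  shows "tangent_plane X {x \<in> points. dot m (A *v x) = 0}"
proof -
  obtain \<alpha> \<beta> c where ab: "\<alpha> \<in> proj_line" "\<beta> \<in> proj_line" "c \<noteq> 0" "m = c *s segre \<alpha> \<beta>"
    using segre_surj assms by blast
  have dot: "dot m (segre s t) = c * (fst \<alpha> * fst s + snd \<alpha> * snd s) * (fst \<beta> * fst t + snd \<beta> * snd t)" for s t
    using ab(4) by (simp add: dot_def segre_def algebra_simps)
  obtain s0 where s0: "s0 \<in> proj_line"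
    "\<And>s. s \<in> proj_line \<Longrightarrow> fst \<alpha> * fst s + snd \<alpha> * snd s = 0 \<longleftrightarrow> s = s0"
    using linear_zero_on_proj_line proj_line_nonzero [OF ab(1)] by metis
  obtain t0 where t0: "t0 \<in> proj_line"
    "\<And>t. t \<in> proj_line \<Longrightarrow> fst \<beta> * fst t + snd \<beta> * snd t = 0 \<longleftrightarrow> t = t0"
    using linear_zero_on_proj_line proj_line_nonzero [OF ab(2)] by metis
  have zero: "dot m (A *v pt s t) = 0 \<longleftrightarrow> s = s0 \<or> t = t0" if "s \<in> proj_line" "t \<in> proj_line" for s t
    using that ab(3) s0 t0 by (simp add: dot_pt_eq_0_iff dot)
  have sub: "s_line s0 \<union> t_line t0 \<subseteq> X"
    using s_line_subset t_line_subset s0 t0 by blast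
  have "{x \<in> points. dot m (A *v x) = 0} \<inter> X = s_line s0 \<union> t_line t0"
  proof (intro equalityI subsetI)
    fix x assume x: "x \<in> {x \<in> points. dot m (A *v x) = 0} \<inter> X"
    then obtain s t where "s \<in> proj_line" "t \<in> proj_line" "x = pt s t"
      using pt_surj by blast
    then show "x \<in> s_line s0 \<union> t_line t0"
      using x zero by (auto simp: s_line_def t_line_def)
  next
    fix x assume x: "x \<in> s_line s0 \<union> t_line t0"
    then have "x \<in> X" "x \<in> points"
      using sub X_eq by auto
    moreover obtain s t where "s \<in> proj_line" "t \<in> proj_line" "x = pt s t" "s = s0 \<or> t = t0"
      using x s0(1) t0(1) unfolding s_line_def t_line_def by blast
    ultimately show "x \<in> {x \<in> points. dot m (A *v x) = 0} \<inter> X"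
      using zero by simp
  qed
  then show ?thesis
    unfolding tangent_plane_def generator_def
    using is_plane_dot [OF assms(1)] s_line_inter_t_line [OF s0(1) t0(1)]
      is_line_s_line [OF s0(1)] is_line_t_line [OF t0(1)] s_line_subset [OF s0(1)] t_line_subset [OF t0(1)]
    by (intro conjI exI [of _ "s_line s0"] exI [of _ "t_line t0"] exI [of _ "pt s0 t0"])
qed

text \<open>For fixed \<open>s\<close> the equation is linear in \<open>t\<close>, and its
  coefficients are the image of \<open>s\<close> under a matrix of determinant \<open>hyp m\<close>.
  They are not both zero, so the section is the graph of a map from \<open>s\<close> to
  \<open>t\<close>.\<close>

lemma card_plane_dot:
  assumes "hyp m \<noteq> 0"
  shows "card ({x \<in> points. dot m (A *v x) = 0} \<inter> X) = CARD('a) + 1"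
proof -
  have "\<exists>t\<in>proj_line. \<forall>t'\<in>proj_line. dot m (segre s t') = 0 \<longleftrightarrow> t' = t" if s: "s \<in> proj_line" for s
  proof -
    have "m $ 0 * fst s + m $ 2 * snd s \<noteq> 0 \<or> m $ 1 * fst s + m $ 3 * snd s \<noteq> 0"
    proof (rule ccontr)
      assume "\<not> ?thesis"
      then have z: "m $ 0 * fst s + m $ 2 * snd s = 0" "m $ 1 * fst s + m $ 3 * snd s = 0"
        by auto
      \<comment> \<open>Cramer's rule for the system \<open>z\<close>.\<close>
      have "hyp m * fst s = m $ 3 * (m $ 0 * fst s + m $ 2 * snd s) - m $ 2 * (m $ 1 * fst s + m $ 3 * snd s)"
        "hyp m * snd s = m $ 0 * (m $ 1 * fst s + m $ 3 * snd s) - m $ 1 * (m $ 0 * fst s + m $ 2 * snd s)"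
        by (simp_all add: hyp_def algebra_simps)
      then have "fst s = 0 \<and> snd s = 0"
        unfolding z using assms by simp
      then show False
        using s proj_line_nonzero by blast
    qed
    then show ?thesis
      unfolding dot_segre using linear_zero_on_proj_line by metis
  qed
  then obtain T where T: "\<And>s. s \<in> proj_line \<Longrightarrow> T s \<in> proj_line"
    "\<And>s t. s \<in> proj_line \<Longrightarrow> t \<in> proj_line \<Longrightarrow> dot m (segre s t) = 0 \<longleftrightarrow> t = T s"
    by metis
  have "{x \<in> points. dot m (A *v x) = 0} \<inter> X = {x \<in> X. dot m (A *v x) = 0}"
    using X_eq by auto
  also have "card \<dots> = card {(s, t) \<in> proj_line \<times> proj_line. dot m (A *v pt s t) = 0}"
    by (rule card_pt)
  also have "{(s, t) \<in> proj_line \<times> proj_line. dot m (A *v pt s t) = 0} = (\<lambda>s. (s, T s)) ` proj_line"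
    by (auto simp: dot_pt_eq_0_iff T)
  also have "card \<dots> = card (proj_line :: ('a \<times> 'a) set)"
    by (rule card_image) (simp add: inj_on_def)
  finally show ?thesis
    by (simp add: card_proj_line)
qed

text \<open>Non-tangency is defined by negation; by \<open>tangent_plane_dot\<close> it forces
  \<open>hyp m \<noteq> 0\<close> for the equation \<open>m\<close> of the plane, and then the count
  is that of \<open>card_plane_dot\<close>.\<close>

lemma card_non_tangent_plane_inter:
  assumes "non_tangent_plane X P"
  shows "card (P \<inter> X) = CARD('a) + 1"
proof -
  obtain S where S: "vec.subspace S" "vec.dim S = 3" "P = S \<inter> points"
    using assms by (auto simp: non_tangent_plane_def is_plane_def)
  obtain a where a: "a \<noteq> 0" "S = {x. dot a x = 0}"
    using hyperplane_equation S by metis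
  obtain m where m: "m \<noteq> 0" "\<And>x. dot a x = dot m (A *v x)"
    using hyperplane_pullback a(1) by metis
  have P: "P = {x \<in> points. dot m (A *v x) = 0}"
    using S(3) a m(2) by auto
  then show ?thesis
    using assms card_plane_dot tangent_plane_dot m(1) unfolding non_tangent_plane_def by blast
qed

text \<open>On the quadric \<open>y0\<close> is, up to a scalar, the product of the first entries of
  both parameters. Nonzeros thus lie in the chart \<open>s = (1, u)\<close>,
  \<open>t = (1, v)\<close>, where the Segre point is \<open>(1, v, u, u * v)\<close>.\<close>

lemma weight_product:
  assumes "\<And>x. x \<in> X \<Longrightarrow> form_eval f x = (A *v x) $ 0 * dot m (A *v x)"
  shows "weight X (codeword X f) =
    card {(u, v). m $ 0 + m $ 1 * v + m $ 2 * u + m $ 3 * (u * v) \<noteq> 0}"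
proof -
  have first: "(A *v pt s t) $ 0 = 0 \<longleftrightarrow> fst s = 0 \<or> fst t = 0" if "s \<in> proj_line" "t \<in> proj_line" for s t
  proof -
    have "dot (vec4 1 0 0 0) y = y $ 0" for y :: "'a ^ 4"
      by (simp add: dot_def)
    then show ?thesis
      using dot_pt_eq_0_iff [OF that, of "vec4 1 0 0 0"] by (simp add: segre_def)
  qed
  have "weight X (codeword X f) = card {x \<in> X. (A *v x) $ 0 * dot m (A *v x) \<noteq> 0}"
    unfolding weight_def codeword_def using assms by (intro arg_cong [where f = card]) auto
  also have "\<dots> = card {(s, t) \<in> proj_line \<times> proj_line. (A *v pt s t) $ 0 * dot m (A *v pt s t) \<noteq> 0}"
    by (rule card_pt)
  also have "\<dots> = card {(s, t) \<in> proj_line \<times> proj_line. fst s \<noteq> 0 \<and> fst t \<noteq> 0 \<and> dot m (segre s t) \<noteq> 0}"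
    by (intro arg_cong [where f = card]) (auto simp: first dot_pt_eq_0_iff)
  also have "\<dots> = card ((\<lambda>(u, v). ((1 :: 'a, u), (1 :: 'a, v))) ` {(u, v). m $ 0 + m $ 1 * v + m $ 2 * u + m $ 3 * (u * v) \<noteq> 0})"
  proof (intro arg_cong [where f = card] equalityI subsetI)
    fix z assume "z \<in> {(s, t). (s, t) \<in> proj_line \<times> proj_line \<and> fst s \<noteq> 0 \<and> fst t \<noteq> 0 \<and> dot m (segre s t) \<noteq> 0}"
    then obtain s t where z: "z = (s, t)" "s \<in> proj_line" "t \<in> proj_line" "fst s \<noteq> 0" "fst t \<noteq> 0" "dot m (segre s t) \<noteq> 0"
      by auto
    then obtain u v where "s = (1, u)" "t = (1, v)"
      by (auto simp: proj_line_def)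
    then show "z \<in> (\<lambda>(u, v). ((1, u), (1, v))) ` {(u, v). m $ 0 + m $ 1 * v + m $ 2 * u + m $ 3 * (u * v) \<noteq> 0}"
      using z by (force simp: dot_segre algebra_simps)
  qed (auto simp: proj_line_def dot_segre algebra_simps)
  also have "\<dots> = card {(u, v). m $ 0 + m $ 1 * v + m $ 2 * u + m $ 3 * (u * v) \<noteq> 0}"
    by (rule card_image) (auto simp: inj_on_def)
  finally show ?thesis .
qed

section \<open>Moving generators and factoring forms with many zeros\<close>

lemma frame_change:
  assumes "N ** M = mat 1" "M ** N = mat 1" "\<And>y. hyp (N *v y) = hyp y"
  shows "frame (N ** A) (A' ** M) X"
proof
  show "N ** A ** (A' ** M) = mat 1"
    by (metis assms(1) inverse(1) matrix_mul_assoc matrix_mul_lid)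
  show "A' ** M ** (N ** A) = mat 1"
    by (metis assms(2) inverse(2) matrix_mul_assoc matrix_mul_lid)
  show "X = {x \<in> points. hyp (N ** A *v x) = 0}"
    using X_eq assms(3) by (simp flip: matrix_vector_mul_assoc)
qed

text \<open>The change acts on the first parameter alone. The last conclusion records that
  \<open>t\<close> is untouched, so that a second change, in \<open>t\<close>, can follow without
  losing the first.\<close>

lemma frame_change_s:
  assumes "s0 \<in> proj_line"
  obtains B B' where "frame B B' X" "\<And>t. B' *v segre (0, 1) t = A' *v segre s0 t"
    "\<And>s t. \<exists>s'. B' *v segre s t = A' *v segre s' t"
  using assms
proof (cases rule: proj_line_cases)
  case 1
  then show thesis
    using that [of A A'] frame_axioms by blast
next
  case (2 u)
  \<comment> \<open>\<open>?M\<close> is the tensor product of the 2 x 2 matrix with rows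
    \<open>(0, 1)\<close> and \<open>(-1, u)\<close>, which sends \<open>(0, 1)\<close> to
    \<open>(1, u)\<close>, with the identity; \<open>?N\<close> is its inverse. Determinant 1 of the
    small matrix makes both preserve \<open>hyp\<close>.\<close>
  let ?N = "vec4 (vec4 u 0 (-1) 0) (vec4 0 u 0 (-1)) (vec4 1 0 0 0) (vec4 0 1 0 0)"
  let ?M = "vec4 (vec4 0 0 1 0) (vec4 0 0 0 1) (vec4 (-1) 0 u 0) (vec4 0 (-1) 0 u)"
  have N: "?N ** ?M = mat 1" "?M ** ?N = mat 1" "\<And>y. hyp (?N *v y) = hyp y"
    by (simp_all add: vec4_eq_iff matrix_matrix_mult_def mat_def sum_index mat_vec4 hyp_def algebra_simps)
  have M: "?M *v segre s t = segre (snd s, u * snd s - fst s) t" for s t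
    by (simp add: vec4_eq_iff mat_vec4 segre_def algebra_simps)
  show thesis
    using that [OF frame_change [OF N]] 2 by (auto simp: M simp flip: matrix_vector_mul_assoc)
qed

lemma frame_change_t:
  assumes "t0 \<in> proj_line"
  obtains B B' where "frame B B' X" "\<And>s. B' *v segre s (0, 1) = A' *v segre s t0"
    "\<And>s t. \<exists>t'. B' *v segre s t = A' *v segre s t'"
  using assms
proof (cases rule: proj_line_cases)
  case 1
  then show thesis
    using that [of A A'] frame_axioms by blast
next
  case (2 u)
  let ?N = "vec4 (vec4 u (-1) 0 0) (vec4 1 0 0 0) (vec4 0 0 u (-1)) (vec4 0 0 1 0)"
  let ?M = "vec4 (vec4 0 1 0 0) (vec4 (-1) u 0 0) (vec4 0 0 0 1) (vec4 0 0 (-1) u)"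
  have N: "?N ** ?M = mat 1" "?M ** ?N = mat 1" "\<And>y. hyp (?N *v y) = hyp y"
    by (simp_all add: vec4_eq_iff matrix_matrix_mult_def mat_def sum_index mat_vec4 hyp_def algebra_simps)
  have M: "?M *v segre s t = segre s (snd t, u * snd t - fst t)" for s t
    by (simp add: vec4_eq_iff mat_vec4 segre_def algebra_simps)
  show thesis
    using that [OF frame_change [OF N]] 2 by (auto simp: M simp flip: matrix_vector_mul_assoc)
qed

text \<open>Pigeonhole over the \<open>q + 1\<close> lines of the ruling yields one with three
  zeros, hence with identical vanishing. The conclusion covers all pairs \<open>t\<close>, not only
  normalised ones, because later frame changes produce unnormalised parameters.\<close>

lemma many_zeros_s_line:
  assumes "f \<in> forms2" "2 * CARD('a) + 2 < card {x \<in> X. form_eval f x = 0}"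
  obtains s0 where "s0 \<in> proj_line" "\<And>t. form_eval f (A' *v segre s0 t) = 0"
proof -
  define g where "g = form_subst A' f"
  have g: "g \<in> forms2" "form_eval f (A' *v y) = form_eval g y" for y
    by (simp_all add: g_def form_subst_forms2 form_eval_subst)
  define Z where "Z s = {t \<in> proj_line. form_eval g (segre s t) = 0}" for s
  have "card {x \<in> X. form_eval f x = 0} = card {(s, t) \<in> proj_line \<times> proj_line. form_eval f (pt s t) = 0}"
    by (rule card_pt)
  also have "{(s, t) \<in> proj_line \<times> proj_line. form_eval f (pt s t) = 0} = Sigma proj_line Z"
    by (auto simp: Z_def form_eval_pt_eq_0_iff g)
  also have "card \<dots> = (\<Sum>s\<in>proj_line. card (Z s))"
    by simp
  finally have sum: "2 * CARD('a) + 2 < (\<Sum>s\<in>proj_line. card (Z s))"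
    using assms(2) by simp
  have "\<exists>s0\<in>proj_line. 2 < card (Z s0)"
  proof (rule ccontr)
    assume "\<not> ?thesis"
    then have "(\<Sum>s\<in>proj_line. card (Z s)) \<le> card (proj_line :: ('a \<times> 'a) set) * 2"
      using sum_bounded_above [of proj_line "\<lambda>s. card (Z s)" 2] by (simp add: not_less)
    then show False
      using sum by (simp add: card_proj_line)
  qed
  then obtain s0 where s0: "s0 \<in> proj_line" "2 < card (Z s0)" by blast
  \<comment> \<open>Coefficients, in the entries of \<open>t\<close>, of the restriction of
    \<open>g\<close> to the line with parameter \<open>s0\<close>.\<close>
  define a where "a = g $ 0 $ 0 * (fst s0)\<^sup>2 + g $ 0 $ 2 * (fst s0 * snd s0) + g $ 2 $ 2 * (snd s0)\<^sup>2"
  define b where "b = g $ 0 $ 1 * (fst s0)\<^sup>2 + (g $ 0 $ 3 + g $ 1 $ 2) * (fst s0 * snd s0) + g $ 2 $ 3 * (snd s0)\<^sup>2"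
  define c where "c = g $ 1 $ 1 * (fst s0)\<^sup>2 + g $ 1 $ 3 * (fst s0 * snd s0) + g $ 3 $ 3 * (snd s0)\<^sup>2"
  have quad: "form_eval g (segre s0 t) = a * (fst t)\<^sup>2 + b * (fst t * snd t) + c * (snd t)\<^sup>2" for t
    by (simp add: form_eval_expand [OF g(1)] segre_def a_def b_def c_def power2_eq_square algebra_simps)
  have "a = 0 \<and> b = 0 \<and> c = 0"
    using s0(2) unfolding Z_def quad by (rule quadratic_zero_on_proj_line)
  then show thesis
    using that [OF s0(1)] quad g(2) by simp
qed

text \<open>Transposition of the 2 x 2 matrix: it keeps \<open>hyp\<close> and exchanges the
  rulings, so results on lines of the first ruling carry over to the second.\<close>

definition swap :: "'a ^ 4 ^ 4"
  where "swap = vec4 (vec4 1 0 0 0) (vec4 0 0 1 0) (vec4 0 1 0 0) (vec4 0 0 0 1)"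

lemma swap_segre: "swap *v segre s t = segre t s"
  by (simp add: vec4_eq_iff mat_vec4 segre_def swap_def algebra_simps)

lemma frame_swap: "frame (swap ** A) (A' ** swap) X"
  by (rule frame_change)
    (simp_all add: swap_def vec4_eq_iff matrix_matrix_mult_def mat_def sum_index mat_vec4 hyp_def algebra_simps)

lemma many_zeros_t_line:
  assumes "f \<in> forms2" "2 * CARD('a) + 2 < card {x \<in> X. form_eval f x = 0}"
  obtains t0 where "t0 \<in> proj_line" "\<And>s. form_eval f (A' *v segre s t0) = 0"
proof -
  interpret swapped: frame "swap ** A" "A' ** swap" X
    by (rule frame_swap)
  show thesis
    using swapped.many_zeros_s_line [OF assms] that
    by (simp add: swap_segre flip: matrix_vector_mul_assoc) blast
qed

lemma many_zeros_product:
  assumes q: "CARD('a) \<ge> 3" and f: "f \<in> forms2" "2 * CARD('a) + 2 < card {x \<in> X. form_eval f x = 0}"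
  obtains B B' m where "frame B B' X" "\<And>x. x \<in> X \<Longrightarrow> form_eval f x = (B *v x) $ 0 * dot m (B *v x)"
proof -
  obtain s0 where s0: "s0 \<in> proj_line" "\<And>t. form_eval f (A' *v segre s0 t) = 0"
    by (rule many_zeros_s_line [OF f]) (rule that)
  obtain t0 where t0: "t0 \<in> proj_line" "\<And>s. form_eval f (A' *v segre s t0) = 0"
    by (rule many_zeros_t_line [OF f]) (rule that)
  obtain C C' where C: "frame C C' X" "\<And>t. C' *v segre (0, 1) t = A' *v segre s0 t"
    "\<And>s t. \<exists>s'. C' *v segre s t = A' *v segre s' t"
    by (rule frame_change_s [OF s0(1)]) (rule that)
  obtain B B' where B: "frame B B' X" "\<And>s. B' *v segre s (0, 1) = C' *v segre s t0"
    "\<And>s t. \<exists>t'. B' *v segre s t = C' *v segre s t'"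
    by (rule frame.frame_change_t [OF C(1) t0(1)]) (rule that)
  interpret B: frame B B' X by (rule B(1))
  define g where "g = form_subst B' f"
  have g: "g \<in> forms2" "form_eval f (B' *v y) = form_eval g y" for y
    by (simp_all add: g_def form_subst_forms2 form_eval_subst)
  \<comment> \<open>The first change altered only \<open>s\<close>, the second only
    \<open>t\<close>. In the new frame both lines are therefore at parameter
    \<open>(0, 1)\<close>.\<close>
  have s_zero: "form_eval g (segre (0, 1) t) = 0" for t
    using B(3) C(2) s0(2) g(2) by metis
  have t_zero: "form_eval g (segre s (0, 1)) = 0" for s
    using B(2) C(3) t0(2) g(2) by metis
  \<comment> \<open>On the line \<open>s = (0, 1)\<close> only \<open>y2\<close> and
    \<open>y3\<close> survive, on \<open>t = (0, 1)\<close> only \<open>y1\<close> and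
    \<open>y3\<close>; vanishing on all \<open>q + 1\<close> points kills the corresponding
    coefficients.\<close>
  have "g $ 2 $ 2 * (fst t)\<^sup>2 + g $ 2 $ 3 * (fst t * snd t) + g $ 3 $ 3 * (snd t)\<^sup>2 = 0" for t
    using s_zero [of t] by (simp add: form_eval_expand [OF g(1)] segre_def power2_eq_square algebra_simps)
  then have z1: "g $ 2 $ 2 = 0 \<and> g $ 2 $ 3 = 0 \<and> g $ 3 $ 3 = 0"
    using q by (intro quadratic_zero_on_proj_line) (simp add: card_proj_line)
  have "g $ 1 $ 1 * (fst s)\<^sup>2 + g $ 1 $ 3 * (fst s * snd s) + g $ 3 $ 3 * (snd s)\<^sup>2 = 0" for s
    using t_zero [of s] by (simp add: form_eval_expand [OF g(1)] segre_def power2_eq_square algebra_simps)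
  then have z2: "g $ 1 $ 1 = 0 \<and> g $ 1 $ 3 = 0 \<and> g $ 3 $ 3 = 0"
    using q by (intro quadratic_zero_on_proj_line) (simp add: card_proj_line)
  \<comment> \<open>The only remaining monomial without \<open>y0\<close> is \<open>y1 y2\<close>,
    which equals \<open>y0 y3\<close> on the quadric; its coefficient joins that of
    \<open>y0 y3\<close>.\<close>
  define m where "m = vec4 (g $ 0 $ 0) (g $ 0 $ 1) (g $ 0 $ 2) (g $ 0 $ 3 + g $ 1 $ 2)"
  have "form_eval f x = (B *v x) $ 0 * dot m (B *v x)" if "x \<in> X" for x
  proof -
    let ?y = "B *v x"
    have "?y $ 1 * ?y $ 2 = ?y $ 0 * ?y $ 3"
      using that B.X_eq by (simp add: hyp_def)
    then have "form_eval g ?y = ?y $ 0 * dot m ?y"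
      by (simp add: form_eval_expand [OF g(1)] z1 z2 m_def dot_def algebra_simps)
    then show ?thesis
      using g(2) [of ?y] by simp
  qed
  then show thesis
    using that B(1) by blast
qed

end

section \<open>Coordinates for a hyperbolic quadric\<close>

text \<open>The symmetric bilinear form attached to \<open>f\<close>, taken without the factor 1/2
  so that it makes sense in characteristic 2.\<close>

definition polar :: "'a::field ^ 4 ^ 4 \<Rightarrow> 'a ^ 4 \<Rightarrow> 'a ^ 4 \<Rightarrow> 'a"
  where "polar f x y = form_eval f (x + y) - form_eval f x - form_eval f y"

lemma form_eval_add: "form_eval f (x + y) = form_eval f x + form_eval f y + polar f x y"
  by (simp add: polar_def)

lemma polar_expand: "polar f x y = (\<Sum>i\<in>UNIV. \<Sum>j\<in>UNIV. f $ i $ j * (x $ i * y $ j + x $ j * y $ i))"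
  by (simp add: polar_def form_eval_def algebra_simps flip: sum_subtractf sum.distrib)

lemma polar_add_right: "polar f x (y + z) = polar f x y + polar f x z"
  and polar_scale_right: "polar f x (c *s y) = c * polar f x y"
  and polar_diff_right: "polar f x (y - z) = polar f x y - polar f x z"
  by (simp_all add: polar_expand algebra_simps sum_distrib_left flip: sum_subtractf sum.distrib)

lemma polar_commute: "polar f x y = polar f y x"
  by (simp add: polar_def algebra_simps)

lemma polar_self: "polar f x x = 2 * form_eval f x"
  by (simp add: polar_expand form_eval_def sum_distrib_left algebra_simps)

lemma polar_minus_right: "polar f x (- y) = - polar f x y"
  using polar_scale_right [of f x "-1" y] by simp

lemmas polar_right = polar_add_right polar_scale_right polar_diff_right polar_minus_right

lemma polar_left:
  "polar f (x + y) z = polar f x z + polar f y z"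
  "polar f (c *s x) z = c * polar f x z"
  "polar f (- x) z = - polar f x z"
  by (simp_all add: polar_commute [of f _ z] polar_right)

lemma form_eval_minus: "form_eval f (- x) = form_eval f x"
  by (simp add: form_eval_def)

lemma form_eval_diff_scale: "form_eval f (x - c *s y) = form_eval f x + c\<^sup>2 * form_eval f y - c * polar f x y"
proof -
  have "x - c *s y = x + (- c) *s y"
    by simp
  then show ?thesis
    by (metis (no_types, lifting) form_eval_add form_eval_scale polar_scale_right diff_conv_add_uminus
        mult_minus_left power2_minus)
qed

lemma form_eval_axis: "form_eval f (axis i 1) = f $ i $ i"
  by (simp add: form_eval_def axis_def if_distrib [of "\<lambda>c. _ * c"] if_distribR cong: if_cong)

lemma polar_axis: "polar f (axis i 1) (axis j 1) = f $ i $ j + f $ j $ i"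
proof -
  have "polar f x y = (\<Sum>i\<in>UNIV. \<Sum>j\<in>UNIV. f $ i $ j * (x $ i * y $ j)) + (\<Sum>j\<in>UNIV. \<Sum>i\<in>UNIV. f $ i $ j * (x $ j * y $ i))" for x y
    unfolding polar_expand distrib_left sum.distrib by (simp, rule sum.swap)
  then show ?thesis
    by (simp add: axis_def if_distrib [of "\<lambda>c. _ * c"] if_distribR cong: if_cong)
qed

lemma invertible_4I:
  fixes A :: "'a::field ^ 4 ^ 4"
  assumes "\<And>x. A *v x = 0 \<Longrightarrow> x = 0"
  shows "invertible A"
  using assms matrix_left_invertible_ker invertible_left_inverse by blast

text \<open>A singular vector orthogonal to everything could be made a coordinate vector. Its
  indeterminate would then vanish from the form, leaving at most three.\<close>

lemma rank_4_no_singular_radical_vector: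
  fixes f :: "'a::field ^ 4 ^ 4"
  assumes f: "form_rank f = 4" and r: "r \<noteq> 0" "form_eval f r = 0"
  shows "\<exists>y. polar f r y = 1"
proof (rule ccontr)
  assume no: "\<not> ?thesis"
  have radical: "polar f r y = 0" for y
  proof (rule ccontr)
    assume "polar f r y \<noteq> 0"
    then have "polar f r (inverse (polar f r y) *s y) = 1"
      by (simp add: polar_scale_right)
    then show False
      using no by blast
  qed
  obtain i where i: "r $ i \<noteq> 0"
    using r(1) by (auto simp: vec_eq_iff)
  \<comment> \<open>The identity with column \<open>i\<close> replaced by \<open>r\<close>; it is
    invertible because \<open>r $ i\<close> is nonzero.\<close>
  define A :: "'a ^ 4 ^ 4" where "A = (\<chi> k l. if l = i then r $ k else if k = l then 1 else 0)"
  have A: "(A *v x) $ k = (if k = i then x $ i * r $ i else x $ i * r $ k + x $ k)" for x k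
  proof -
    have "(A *v x) $ k = (\<Sum>l\<in>UNIV. (if l = i then r $ k * x $ i else 0) + (if l = k \<and> k \<noteq> i then x $ k else 0))"
      unfolding matrix_vector_mult_def A_def by (simp, rule sum.cong) auto
    then show ?thesis
      by (simp add: sum.distrib)
  qed
  have "invertible A"
  proof (rule invertible_4I)
    fix x assume x: "A *v x = 0"
    then have "x $ i = 0"
      using A [of x i] i by simp
    then have "x $ k = 0" for k
      using A [of x k] x by (cases "k = i") auto
    then show "x = 0"
      by (simp add: vec_eq_iff)
  qed
  define g where "g = form_subst A f"
  have g: "g \<in> forms2" "form_eval g y = form_eval f (A *v y)" for y
    by (simp_all add: g_def form_subst_forms2 form_eval_subst)
  have Ai: "A *v axis i 1 = r"
    unfolding vec_eq_iff A by (simp add: axis_def)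
  have "polar g (axis i 1) y = 0" for y
    using radical [of "A *v y"] by (simp add: polar_def g(2) matrix_vector_right_distrib Ai)
  then have sum0: "g $ i $ l + g $ l $ i = 0" for l
    by (metis polar_axis)
  \<comment> \<open>In characteristic 2 the polar form does not see the diagonal coefficient; the
    singularity of \<open>r\<close> supplies it.\<close>
  have diag: "g $ i $ i = 0"
    using r(2) g(2) [of "axis i 1"] by (simp add: Ai form_eval_axis)
  have "g $ i $ l = 0 \<and> g $ l $ i = 0" for l
  proof -
    consider "l < i" | "l = i" | "i < l"
      by (rule linorder_cases)
    then show ?thesis
      using sum0 [of l] diag g(1) by cases (auto simp: forms2_def)
  qed
  then have "form_indets g \<subseteq> UNIV - {i}"
    by (auto simp: form_indets_def)
  then have "card (form_indets g) \<le> card (UNIV - {i})"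
    by (intro card_mono) auto
  then have "card (form_indets g) \<le> 3"
    by (simp add: card_Diff_singleton)
  moreover have "form_rank f \<le> card (form_indets g)"
    unfolding form_rank_def g_def using \<open>invertible A\<close> by (intro Least_le) blast
  ultimately show False
    using f by simp
qed

lemma card_not_orthogonal_le:
  fixes f :: "'a::{field,finite} ^ 4 ^ 4"
  assumes e: "form_eval f e = 0" and y: "polar f e y = 1"
  shows "card {x \<in> zero_set f. polar f e x \<noteq> 0} \<le> CARD('a)\<^sup>2"
proof -
  \<comment> \<open>The injection \<open>(v, c, k) \<mapsto> v + c e + k y\<close> of \<open>T \<times> F \<times> F\<close> into the whole space gives
    \<open>|T| \<le> q\<^sup>2\<close>.\<close>
  define T where "T = {v. polar f e v = 1 \<and> form_eval f v = 0}"
  have ee: "polar f e e = 0"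
    using e by (simp add: polar_self)
  \<comment> \<open>Every such point has a multiple with polar value 1 against \<open>e\<close>, and
    distinct points have distinct multiples.\<close>
  have "card {x \<in> zero_set f. polar f e x \<noteq> 0} \<le> card T"
  proof (rule card_inj_on_le)
    show "inj_on (\<lambda>x. inverse (polar f e x) *s x) {x \<in> zero_set f. polar f e x \<noteq> 0}"
    proof (rule inj_onI)
      fix x z assume x: "x \<in> {x \<in> zero_set f. polar f e x \<noteq> 0}" and z: "z \<in> {x \<in> zero_set f. polar f e x \<noteq> 0}"
        and eq: "inverse (polar f e x) *s x = inverse (polar f e z) *s z"
      have "x = polar f e x *s (inverse (polar f e x) *s x)"
        using x by simp
      also have "\<dots> = (polar f e x * inverse (polar f e z)) *s z"
        unfolding eq by simp
      finally show "x = z"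
        using points_unique x z by (simp add: zero_set_def) blast
    qed
    show "(\<lambda>x. inverse (polar f e x) *s x) ` {x \<in> zero_set f. polar f e x \<noteq> 0} \<subseteq> T"
      by (auto simp: T_def zero_set_def polar_scale_right form_eval_scale)
  qed auto
  moreover have "card (T \<times> (UNIV :: 'a set) \<times> (UNIV :: 'a set)) \<le> CARD('a ^ 4)"
  proof (rule card_inj_on_le)
    show "inj_on (\<lambda>(v, c, k). v + c *s e + k *s y) (T \<times> UNIV \<times> UNIV)"
    proof (rule inj_onI, clarsimp)
      fix v c k v' c' k'
      assume v: "v \<in> T" "v' \<in> T" and eq: "v + c *s e + k *s y = v' + c' *s e + k' *s y"
      \<comment> \<open>Pairing with \<open>e\<close> recovers \<open>k\<close>; once
        \<open>k\<close> is removed, the value of \<open>f\<close> recovers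
        \<open>c\<close>.\<close>
      have "polar f e (v + c *s e + k *s y) = 1 + k" if "v \<in> T" for v c k
        using that by (simp add: T_def polar_right ee y)
      then have k: "k = k'"
        using v eq by (metis add_left_cancel)
      then have eq': "v + c *s e = v' + c' *s e"
        using eq by simp
      have "form_eval f (v + c *s e) = c" if "v \<in> T" for v c
        using that polar_commute [of f v e] by (simp add: T_def form_eval_add form_eval_scale polar_scale_right e)
      then have "c = c'"
        using v eq' by metis
      then show "v = v' \<and> c = c' \<and> k = k'"
        using k eq' by simp
    qed
  qed auto
  ultimately have "card {x \<in> zero_set f. polar f e x \<noteq> 0} * (CARD('a) * CARD('a)) \<le> CARD('a) ^ 4"
    by (simp add: card_cartesian_product) (meson le_trans mult_le_mono1)
  then have "card {x \<in> zero_set f. polar f e x \<noteq> 0} * (CARD('a))\<^sup>2 \<le> (CARD('a))\<^sup>2 * (CARD('a))\<^sup>2"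
    by (simp add: power2_eq_square power4_eq_xxxx mult.assoc)
  then show ?thesis
    by (rule mult_right_le_imp_le) simp
qed

text \<open>Two points of \<open>X\<close> orthogonal to each other can be completed to two
  orthogonal hyperbolic pairs \<open>e\<close>, \<open>e'\<close> and \<open>g\<close>,
  \<open>h\<close>. In this basis only the coefficients of the two pairs remain.\<close>

lemma hyperbolic_quadric_frame:
  fixes X :: "('a::{field,finite} ^ 4) set"
  assumes "hyperbolic_quadric X"
  obtains A A' where "frame A A' X"
proof -
  obtain f where f: "form_rank f = 4" "X = zero_set f" and card: "card X = (CARD('a) + 1)\<^sup>2"
    using assms by (auto simp: hyperbolic_quadric_def)
  note partner = rank_4_no_singular_radical_vector [OF f(1)]
  have "X \<noteq> {}"
    using card by auto
  then obtain e where "e \<in> X" by blast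
  then have e: "e \<in> points" "form_eval f e = 0" "e \<noteq> 0"
    using f(2) points_nonzero by (auto simp: zero_set_def)
  obtain y where y: "polar f e y = 1"
    using partner e by blast
  \<comment> \<open>This is where the number of points excludes an elliptic quadric, which has only \<open>q\<^sup>2 + 1\<close>.\<close>
  have "\<exists>x\<in>X. x \<noteq> e \<and> polar f e x = 0"
  proof (rule ccontr)
    assume "\<not> ?thesis"
    then have "X \<subseteq> insert e {x \<in> zero_set f. polar f e x \<noteq> 0}"
      using f(2) by blast
    then have "card X \<le> card (insert e {x \<in> zero_set f. polar f e x \<noteq> 0})"
      by (intro card_mono) auto
    also have "\<dots> \<le> 1 + CARD('a)\<^sup>2"
      using card_insert_le_m1 card_not_orthogonal_le [OF e(2) y]
      by (metis (no_types, lifting) Suc_eq_plus1_left card_insert_le_m1 card_insert_if finite le_SucI not_less_eq_eq)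
    finally show False
      using card by (simp add: power2_eq_square)
  qed
  then obtain x where x: "x \<in> points" "form_eval f x = 0" "x \<noteq> e" "polar f e x = 0"
    using f(2) by (auto simp: zero_set_def)
  have ee: "polar f e e = 0"
    using e by (simp add: polar_self)
  \<comment> \<open>Subtracting \<open>c *s e\<close> from \<open>y\<close> lowers the value of
    \<open>f\<close> by \<open>c\<close> and keeps the pairing with \<open>e\<close>, so this choice
    makes the partner singular.\<close>
  define e' where "e' = y - form_eval f y *s e"
  have e': "form_eval f e' = 0" "polar f e e' = 1" "polar f e' e = 1"
    using y polar_commute [of f y e] polar_commute [of f e' e]
    by (simp_all add: e'_def form_eval_diff_scale polar_right e ee)
  have e'e': "polar f e' e' = 0"
    using e' by (simp add: polar_self)
  \<comment> \<open>As \<open>x\<close> and \<open>e\<close> are orthogonal and singular, adding a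
    multiple of \<open>e\<close> keeps \<open>x\<close> singular and orthogonal to \<open>e\<close>;
    this multiple also makes it orthogonal to \<open>e'\<close>.\<close>
  define g where "g = x - polar f e' x *s e"
  have g: "form_eval f g = 0" "polar f e g = 0" "polar f e' g = 0" "polar f g e = 0" "polar f g e' = 0"
    using x polar_commute [of f x e] polar_commute [of f g e] polar_commute [of f g e']
    by (simp_all add: g_def form_eval_diff_scale polar_right e e' ee)
  have "g \<noteq> 0"
  proof
    assume "g = 0"
    then have "x = polar f e' x *s e"
      by (simp add: g_def)
    then show False
      using points_unique x(1,3) e(1) by blast
  qed
  then obtain z where z: "polar f g z = 1"
    using partner g by blast
  have gg: "polar f g g = 0"
    using g by (simp add: polar_self)
  \<comment> \<open>Projection of \<open>z\<close> away from the pair \<open>e\<close>,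
    \<open>e'\<close>; the pairing with \<open>g\<close> stays 1 because \<open>g\<close> is
    orthogonal to both.\<close>
  define h0 where "h0 = z - polar f e' z *s e - polar f e z *s e'"
  have h0: "polar f g h0 = 1" "polar f e h0 = 0" "polar f e' h0 = 0"
    by (simp_all add: h0_def polar_right z g ee e' e'e')
  define h where "h = h0 - form_eval f h0 *s g"
  have h: "form_eval f h = 0" "polar f g h = 1" "polar f e h = 0" "polar f e' h = 0"
    "polar f h g = 1" "polar f h e = 0" "polar f h e' = 0"
    using polar_commute [of f h0 g] polar_commute [of f h g] polar_commute [of f h e] polar_commute [of f h e']
    by (simp_all add: h_def form_eval_diff_scale polar_right h0 g gg)
  have hh: "polar f h h = 0"
    using h by (simp add: polar_self)
  \<comment> \<open>The sign of \<open>h\<close> produces \<open>- v1 v2\<close>, as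
    \<open>hyp\<close> demands.\<close>
  define A' where "A' = transpose (vec4 e g (- h) e')"
  have A': "A' *v v = v $ 0 *s e + v $ 1 *s g + (- v $ 2) *s h + v $ 3 *s e'" for v
    by (simp add: vec4_eq_iff mat_vec4 A'_def transpose_def algebra_simps)
  \<comment> \<open>Pairing with the basis vectors reads off the coordinates up to sign, which gives
    invertibility.\<close>
  have polars: "polar f e (A' *v v) = v $ 3" "polar f e' (A' *v v) = v $ 0"
    "polar f g (A' *v v) = - v $ 2" "polar f h (A' *v v) = v $ 1" for v
    unfolding A' polar_right by (simp_all add: ee e' g gg h hh e'e')
  have "invertible A'"
  proof (rule invertible_4I)
    fix v assume v: "A' *v v = 0"
    have "polar f u 0 = 0" for u
      using polar_scale_right [of f u 0 0] by simp
    then show "v = 0"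
      using polars [of v] by (simp add: v vec4_eq_iff)
  qed
  then obtain A where A: "A' ** A = mat 1" "A ** A' = mat 1"
    by (auto simp: invertible_def)
  have eval: "form_eval f (A' *v v) = hyp v" for v
    unfolding A' form_eval_add polar_left polar_right
    by (simp add: form_eval_minus form_eval_scale polar_left polar_right e e' g h hyp_def)
  have "hyp (A *v x) = form_eval f x" for x
    using eval [of "A *v x"] by (simp add: matrix_vector_mul_assoc A)
  then have "frame A A' X"
    using A f(2) by unfold_locales (auto simp: zero_set_def)
  then show thesis
    using that by blast
qed

section \<open>Reguli\<close>

lemma line_subset_subspace:
  assumes L: "vec.subspace L" "vec.dim L = 2" and S: "vec.subspace S"
    and x: "x \<in> L \<inter> points" "y \<in> L \<inter> points" "x \<noteq> y" "x \<in> S" "y \<in> S"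
  shows "L \<subseteq> S"
proof -
  have "y \<noteq> 0" "x \<notin> vec.span {y}"
    using x points_nonzero points_unique by (auto simp: vec.span_breakdown_eq)
  then have "vec.independent {x, y}"
    by (simp add: vec.independent_insert)
  then have "vec.dim (vec.span {x, y}) = 2"
    using x(3) by (simp add: vec.dim_span vec.dim_eq_card_independent)
  moreover have "vec.span {x, y} \<subseteq> L"
    using x L(1) by (intro vec.span_minimal) auto
  ultimately have "vec.span {x, y} = L"
    using vec.subspace_dim_equal [of "vec.span {x, y}" L] L by simp
  moreover have "vec.span {x, y} \<subseteq> S"
    using x S by (intro vec.span_minimal) auto
  ultimately show ?thesis
    by simp
qed

lemma lines_share_one_point:
  assumes "is_line l" "is_line m" "x \<in> l \<inter> m" "y \<in> l \<inter> m" "x \<noteq> y"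
  shows "l = m"
proof -
  obtain L M where "vec.subspace L" "vec.dim L = 2" "l = L \<inter> points"
    "vec.subspace M" "vec.dim M = 2" "m = M \<inter> points"
    using assms(1,2) by (auto simp: is_line_def)
  then show ?thesis
    using line_subset_subspace [of L M x y] line_subset_subspace [of M L x y] assms by blast
qed

text \<open>Two transversals through a common point would span a plane containing two of the three
  skew lines.\<close>

lemma regulus_disjoint:
  assumes "regulus R" "m \<in> R" "m' \<in> R" "m \<noteq> m'"
  shows "m \<inter> m' = {}"
proof (rule ccontr)
  assume "m \<inter> m' \<noteq> {}"
  then obtain p where p: "p \<in> m" "p \<in> m'" by blast
  obtain l1 l2 l3 where l: "is_line l1" "is_line l2" "is_line l3"
    "l1 \<inter> l2 = {}" "l1 \<inter> l3 = {}" "l2 \<inter> l3 = {}"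
    and R: "R = {m. is_line m \<and> m \<inter> l1 \<noteq> {} \<and> m \<inter> l2 \<noteq> {} \<and> m \<inter> l3 \<noteq> {}}"
    using assms(1) by (auto simp: regulus_def)
  obtain M where M: "vec.subspace M" "vec.dim M = 2" "m = M \<inter> points"
    using assms(2) R by (auto simp: is_line_def)
  obtain M' where M': "vec.subspace M'" "vec.dim M' = 2" "m' = M' \<inter> points"
    using assms(3) R by (auto simp: is_line_def)
  define H where "H = {x + y |x y. x \<in> M \<and> y \<in> M'}"
  have H: "vec.subspace H"
    unfolding H_def using M(1) M'(1) by (rule vec.subspace_sums)
  have "M \<subseteq> H" "M' \<subseteq> H"
    unfolding H_def using M(1) M'(1) vec.subspace_0 by force+
  have "vec.dim (M \<inter> M') \<noteq> 0"
    using p M(3) M'(3) points_nonzero by auto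
  then have dimH: "vec.dim H \<le> 3"
    using vec.dim_sums_Int [OF M(1) M'(1)] M(2) M'(2) unfolding H_def by linarith
  \<comment> \<open>Missing \<open>p\<close>, the line meets \<open>m\<close> and \<open>m'\<close>
    in different points, and these two points place it in \<open>H\<close>.\<close>
  have transversal: "\<exists>L. vec.subspace L \<and> vec.dim L = 2 \<and> l = L \<inter> points \<and> L \<subseteq> H"
    if l: "is_line l" "p \<notin> l" "m \<inter> l \<noteq> {}" "m' \<inter> l \<noteq> {}" for l
  proof -
    obtain L where L: "vec.subspace L" "vec.dim L = 2" "l = L \<inter> points"
      using \<open>is_line l\<close> by (auto simp: is_line_def)
    obtain x y where x: "x \<in> m" "x \<in> l" "y \<in> m'" "y \<in> l"
      using l(3,4) by blast
    have "x \<noteq> y"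
    proof
      assume "x = y"
      then have "m = m'"
        using lines_share_one_point [of m m' p x] x p assms R l(2) by blast
      then show False
        using assms(4) by blast
    qed
    then have "L \<subseteq> H"
      using line_subset_subspace [OF L(1,2) H] x L(3) M(3) M'(3) \<open>M \<subseteq> H\<close> \<open>M' \<subseteq> H\<close> by blast
    then show ?thesis
      using L by blast
  qed
  have clash: False
    if l: "is_line l" "p \<notin> l" "m \<inter> l \<noteq> {}" "m' \<inter> l \<noteq> {}"
      and l': "is_line l'" "p \<notin> l'" "m \<inter> l' \<noteq> {}" "m' \<inter> l' \<noteq> {}" and skew: "l \<inter> l' = {}" for l l'
  proof -
    obtain L where L: "vec.subspace L" "vec.dim L = 2" "l = L \<inter> points" "L \<subseteq> H"
      using transversal [OF l] by blast
    obtain L' where L': "vec.subspace L'" "vec.dim L' = 2" "l' = L' \<inter> points" "L' \<subseteq> H"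
      using transversal [OF l'] by blast
    have "vec.dim H < vec.dim L + vec.dim L'"
      using L L' dimH by simp
    then obtain x where x: "x \<in> L \<inter> L'" "x \<noteq> 0"
      by (rule subspaces_meet [OF L(1) L'(1) H L(4) L'(4)])
    then have "rep x \<in> l \<inter> l'"
      using L L' rep_in_points rep_subspace_iff by blast
    then show False
      using skew by blast
  qed
  \<comment> \<open>The three lines are pairwise disjoint, so \<open>p\<close> lies on at most one
    of them and the other two clash.\<close>
  show False
    using clash [of l1 l2] clash [of l1 l3] clash [of l2 l3] l assms(2,3) unfolding R by blast
qed

lemma planes_meet_in_line:
  assumes "is_plane P" "is_plane Q" "P \<noteq> Q"
  shows "is_line (P \<inter> Q)"
proof -
  obtain S T where ST: "vec.subspace S" "vec.dim S = 3" "P = S \<inter> points"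
    "vec.subspace T" "vec.dim T = 3" "Q = T \<inter> points"
    using assms by (auto simp: is_plane_def)
  then have "vec.dim (S \<inter> T) = 2"
    using assms(3) by (intro distinct_hyperplanes_meet) auto
  moreover have "P \<inter> Q = (S \<inter> T) \<inter> points"
    using ST by blast
  ultimately show ?thesis
    unfolding is_line_def using vec.subspace_inter [OF ST(1) ST(4)] by blast
qed

context frame
begin

lemma s_line_disjoint:
  "\<lbrakk>s \<in> proj_line; s' \<in> proj_line; s \<noteq> s'\<rbrakk> \<Longrightarrow> s_line s \<inter> s_line s' = {}"
  by (auto simp: s_line_def pt_inj)

lemma t_line_disjoint:
  "\<lbrakk>t \<in> proj_line; t' \<in> proj_line; t \<noteq> t'\<rbrakk> \<Longrightarrow> t_line t \<inter> t_line t' = {}"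
  by (auto simp: t_line_def pt_inj)

lemma s_line_neq_t_line:
  assumes "s \<in> proj_line" "t \<in> proj_line"
  shows "s_line s \<noteq> t_line t"
proof
  assume eq: "s_line s = t_line t"
  have "card (s_line s) = CARD('a) + 1"
    by (rule card_is_line [OF is_line_s_line [OF assms(1)]])
  then show False
    using s_line_inter_t_line [OF assms] eq by simp
qed

text \<open>Lines of a regulus are pairwise disjoint, whereas lines of opposite rulings always meet,
  so a regulus inside \<open>X\<close> stays within one ruling. Covering \<open>X\<close> forces it
  to be all of that ruling.\<close>

lemma regulus_of_X:
  assumes "regulus_of X R"
  shows "R = s_line ` proj_line \<or> R = t_line ` proj_line"
proof -
  have reg: "regulus R" "\<Union> R = X"
    using assms by (auto simp: regulus_of_def)
  have one: "(0, 1) \<in> (proj_line :: ('a \<times> 'a) set)"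
    by (simp add: proj_line_def)
  have lines: "(\<exists>s\<in>proj_line. m = s_line s) \<or> (\<exists>t\<in>proj_line. m = t_line t)" if "m \<in> R" for m
  proof (rule lines_in_X)
    show "is_line m"
      using reg(1) that by (auto simp: regulus_def)
    show "m \<subseteq> X"
      using reg(2) that by blast
  qed
  show ?thesis
  proof (cases "\<exists>s\<in>proj_line. s_line s \<in> R")
    case True
    then obtain s0 where s0: "s0 \<in> proj_line" "s_line s0 \<in> R" by blast
    have sub: "\<exists>s\<in>proj_line. m = s_line s" if "m \<in> R" for m
    proof (rule ccontr)
      assume no: "\<not> ?thesis"
      then obtain t where t: "t \<in> proj_line" "m = t_line t"
        using lines \<open>m \<in> R\<close> by blast
      then have "pt s0 t \<in> s_line s0 \<inter> m"
        using s_line_inter_t_line s0(1) by blast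
      then show False
        using regulus_disjoint [OF reg(1) s0(2) \<open>m \<in> R\<close>] no s0(1) by blast
    qed
    have "s_line s \<in> R" if s: "s \<in> proj_line" for s
    proof -
      have "pt s (0, 1) \<in> \<Union> R"
        using reg(2) pt_in_X s one by simp
      then obtain s' where "s' \<in> proj_line" "pt s (0, 1) \<in> s_line s'" "s_line s' \<in> R"
        using sub by blast
      moreover have "pt s (0, 1) \<in> s_line s"
        using one by (simp add: s_line_def)
      ultimately show ?thesis
        using s_line_disjoint s by blast
    qed
    then show ?thesis
      using sub by blast
  next
    case False
    then have sub: "\<exists>t\<in>proj_line. m = t_line t" if "m \<in> R" for m
      using lines that by blast
    have "t_line t \<in> R" if t: "t \<in> proj_line" for t
    proof -
      have "pt (0, 1) t \<in> \<Union> R"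
        using reg(2) pt_in_X t one by simp
      then obtain t' where "t' \<in> proj_line" "pt (0, 1) t \<in> t_line t'" "t_line t' \<in> R"
        using sub by blast
      moreover have "pt (0, 1) t \<in> t_line t"
        using one by (simp add: t_line_def)
      ultimately show ?thesis
        using t_line_disjoint t by blast
    qed
    then show ?thesis
      using sub by blast
  qed
qed

lemma card_regulus_of_X:
  assumes "regulus_of X R"
  shows "card R = CARD('a) + 1"
proof -
  have one: "(0, 1) \<in> (proj_line :: ('a \<times> 'a) set)"
    by (simp add: proj_line_def)
  have "inj_on s_line proj_line"
    using s_line_disjoint one by (fastforce simp: inj_on_def s_line_def)
  moreover have "inj_on t_line proj_line"
    using t_line_disjoint one by (fastforce simp: inj_on_def t_line_def)
  ultimately show ?thesis
    using regulus_of_X [OF assms] by (auto simp: card_image card_proj_line)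
qed

lemma distinct_reguli_lines_meet:
  assumes "regulus_of X R1" "regulus_of X R2" "R1 \<noteq> R2" "g1 \<in> R1" "g2 \<in> R2"
  shows "g1 \<inter> g2 \<noteq> {}"
  using regulus_of_X [OF assms(1)] regulus_of_X [OF assms(2)] assms(3-5) s_line_inter_t_line
  by (auto simp: Int_commute)

text \<open>Two distinct generators that meet belong to opposite rulings. Applied to the second
  quadric, this shows that either of its reguli contains exactly one of the two shared
  generators.\<close>

lemma meeting_lines_split:
  assumes "regulus_of X R" "is_line g1" "g1 \<subseteq> X" "is_line g2" "g2 \<subseteq> X" "g1 \<noteq> g2" "g1 \<inter> g2 \<noteq> {}"
  shows "g1 \<in> R \<longleftrightarrow> g2 \<notin> R"
proof -
  have "(\<exists>s\<in>proj_line. g1 = s_line s) \<or> (\<exists>t\<in>proj_line. g1 = t_line t)"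
    "(\<exists>s\<in>proj_line. g2 = s_line s) \<or> (\<exists>t\<in>proj_line. g2 = t_line t)"
    using lines_in_X assms by auto
  then have "(\<exists>s\<in>proj_line. \<exists>t\<in>proj_line. g1 = s_line s \<and> g2 = t_line t) \<or>
    (\<exists>s\<in>proj_line. \<exists>t\<in>proj_line. g1 = t_line t \<and> g2 = s_line s)"
    using s_line_disjoint t_line_disjoint assms(6,7) by metis
  moreover have "t_line t \<notin> s_line ` proj_line" "s_line t \<notin> t_line ` proj_line" if "t \<in> proj_line" for t
    using s_line_neq_t_line that by fastforce+
  ultimately show ?thesis
    using regulus_of_X [OF assms(1)] by blast
qed

end

text \<open>The regulus of bisecants partitions \<open>Y\<close>: its one shared generator
  contributes \<open>q + 1\<close> points and each of the other \<open>q\<close> lines contributes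
  2.\<close>

lemma card_inter_sharing_two_generators:
  fixes X Y :: "('a::{field,finite} ^ 4) set"
  assumes X: "hyperbolic_quadric X" and XY: "hyperbolic_sharing_two_generators X Y"
  shows "card (X \<inter> Y) = 3 * CARD('a) + 1"
proof -
  have Y: "hyperbolic_quadric Y"
    using XY by (simp add: hyperbolic_sharing_two_generators_def)
  obtain A A' where A: "frame A A' X"
    by (rule hyperbolic_quadric_frame [OF X])
  obtain B B' where B: "frame B B' Y"
    by (rule hyperbolic_quadric_frame [OF Y])
  obtain g1 g2 R1 R2 R where g: "g1 \<noteq> g2" "{g. generator X g \<and> g \<subseteq> Y} = {g1, g2}"
    and R12: "regulus_of X R1" "regulus_of X R2" "R1 \<noteq> R2" "g1 \<in> R1" "g2 \<in> R2"
    and R: "regulus_of Y R" "\<And>l. l \<in> R - {g1, g2} \<Longrightarrow> bisecant X l"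
  proof -
    note XY [unfolded hyperbolic_sharing_two_generators_def, THEN conjunct2]
    then show thesis
      by (elim exE conjE) (rule that; (assumption | erule (1) bspec))
  qed
  have gen: "is_line g1" "g1 \<subseteq> X" "g1 \<subseteq> Y" "is_line g2" "g2 \<subseteq> X" "g2 \<subseteq> Y"
    using g(2) by (auto simp: generator_def)
  \<comment> \<open>The lines meet because of their position on \<open>X\<close>; the next step uses
    this meeting on \<open>Y\<close>.\<close>
  have "g1 \<inter> g2 \<noteq> {}"
    using frame.distinct_reguli_lines_meet [OF A] R12 by blast
  then have split: "g1 \<in> R \<longleftrightarrow> g2 \<notin> R"
    using frame.meeting_lines_split [OF B R(1)] gen g(1) by blast
  then obtain g where g': "g \<in> R" "R - {g1, g2} = R - {g}" "g = g1 \<or> g = g2"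
    by blast
  have "\<Union> R = Y" "regulus R"
    using R(1) by (auto simp: regulus_of_def)
  then have "X \<inter> Y = (\<Union>l\<in>R. l \<inter> X)"
    by blast
  also have "card \<dots> = (\<Sum>l\<in>R. card (l \<inter> X))"
  proof (rule card_UN_disjoint)
    show "\<forall>l\<in>R. \<forall>m\<in>R. l \<noteq> m \<longrightarrow> l \<inter> X \<inter> (m \<inter> X) = {}"
      using regulus_disjoint [OF \<open>regulus R\<close>] by blast
  qed auto
  also have "\<dots> = card (g \<inter> X) + (\<Sum>l\<in>R - {g}. card (l \<inter> X))"
    by (rule sum.remove) (use g' in auto)
  also have "(\<Sum>l\<in>R - {g}. card (l \<inter> X)) = (\<Sum>l\<in>R - {g}. 2)"
    using R(2) g'(2) by (intro sum.cong) (auto simp: bisecant_def)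
  also have "\<dots> = 2 * CARD('a)"
    using g'(1) frame.card_regulus_of_X [OF B R(1)] by simp
  also have "g \<inter> X = g"
    using g'(3) gen by blast
  also have "card g = CARD('a) + 1"
    using g'(3) gen card_is_line by blast
  finally show ?thesis
    by simp
qed

section \<open>Weights\<close>

lemma weight_plus_zeros:
  fixes X :: "('a::{field,finite} ^ 4) set"
  shows "weight X (codeword X f) + card {x \<in> X. form_eval f x = 0} = card X"
proof -
  have "{x \<in> X. codeword X f x \<noteq> 0} = {x \<in> X. form_eval f x \<noteq> 0}"
    by (auto simp: codeword_def)
  then have "weight X (codeword X f) + card {x \<in> X. form_eval f x = 0} =
      card ({x \<in> X. form_eval f x \<noteq> 0} \<union> {x \<in> X. form_eval f x = 0})"
    unfolding weight_def by (subst card_Un_disjoint) auto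
  also have "{x \<in> X. form_eval f x \<noteq> 0} \<union> {x \<in> X. form_eval f x = 0} = X"
    by auto
  finally show ?thesis .
qed

context frame
begin

lemma form_eval_product_frame:
  "form_eval (product_form (transpose A *v a) (transpose A *v b)) x = dot a (A *v x) * dot b (A *v x)"
  by (simp add: form_eval_product dot_mat)

lemma dot_first: "dot (vec4 1 0 0 0) y = y $ 0"
  by (simp add: dot_def)

text \<open>Shows that the affine counts really occur as weights, realised by a tangent plane
  together with another plane.\<close>

lemma weight_of_product:
  "card {(u, v). m $ 0 + m $ 1 * v + m $ 2 * u + m $ 3 * (u * v) \<noteq> 0} \<in> weight X ` functional_code X"
  for m :: "'a ^ 4"
proof -
  let ?f = "product_form (transpose A *v vec4 1 0 0 0) (transpose A *v m)"
  have w: "weight X (codeword X ?f) = card {(u, v). m $ 0 + m $ 1 * v + m $ 2 * u + m $ 3 * (u * v) \<noteq> 0}"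
    by (rule weight_product) (simp only: form_eval_product_frame dot_first)
  have "codeword X ?f \<in> functional_code X"
    unfolding functional_code_def by (intro imageI product_form_forms2)
  from imageI [OF this, of "weight X"] show ?thesis
    unfolding w .
qed

lemma small_weights:
  assumes q: "CARD('a) \<ge> 3" and f: "f \<in> forms2"
  shows "weight X (codeword X f) \<in> {0, (CARD('a) - 1)\<^sup>2} \<or> weight X (codeword X f) \<ge> CARD('a) * (CARD('a) - 1)"
proof (cases "2 * CARD('a) + 2 < card {x \<in> X. form_eval f x = 0}")
  case True
  obtain B B' m where B: "frame B B' X" "\<And>x. x \<in> X \<Longrightarrow> form_eval f x = (B *v x) $ 0 * dot m (B *v x)"
    by (rule many_zeros_product [OF q f True]) (rule that)
  have w: "weight X (codeword X f) = card {(u, v). m $ 0 + m $ 1 * v + m $ 2 * u + m $ 3 * (u * v) \<noteq> 0}"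
    by (rule frame.weight_product [OF B])
  show ?thesis
  proof (cases "m = 0")
    case True
    then show ?thesis
      using w by simp
  next
    case False
    then show ?thesis
      using card_bilinear_nonzero [of m] w by auto
  qed
next
  case False
  \<comment> \<open>Few zeros leave weight at least
    \<open>(q + 1)^2 - (2q + 2) = q^2 - 1\<close>.\<close>
  then have "(CARD('a) + 1)\<^sup>2 \<le> weight X (codeword X f) + (2 * CARD('a) + 2)"
    using weight_plus_zeros [of X f] card_X by linarith
  moreover have "(CARD('a) + 1)\<^sup>2 = CARD('a) * CARD('a) + 2 * CARD('a) + 1"
    by (simp add: power2_eq_square)
  moreover have "CARD('a) * (CARD('a) - 1) = CARD('a) * CARD('a) - CARD('a)"
    by (simp add: diff_mult_distrib2)
  ultimately show ?thesis
    using q by linarith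
qed

lemma second_weight_X:
  assumes q: "CARD('a) \<ge> 3"
  shows "second_weight X = CARD('a) * (CARD('a) - 1)"
proof -
  define a where "a = (CARD('a) - 1)\<^sup>2"
  define b where "b = CARD('a) * (CARD('a) - 1)"
  have ab: "a < b" "a \<noteq> 0"
    using q by (auto simp: a_def b_def power2_eq_square)
  \<comment> \<open>The polynomial \<open>u * v\<close> attains the smallest weight and
    \<open>u\<close> the next one; \<open>small_weights\<close> leaves nothing in between.\<close>
  have "{(u, v). u * v \<noteq> (0::'a)} = (UNIV - {0}) \<times> (UNIV - {0})"
    by auto
  then have "card {(u, v). u * v \<noteq> (0::'a)} = a"
    by (simp add: a_def power2_eq_square card_cartesian_product card_Diff_singleton)
  then have a: "a \<in> nonzero_weights X"
    using weight_of_product [of "vec4 0 0 0 1"] ab(2) by (simp add: nonzero_weights_def)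
  have "{(u, v :: 'a). u \<noteq> (0::'a)} = (UNIV - {0}) \<times> UNIV"
    by auto
  then have "card {(u, v :: 'a). u \<noteq> (0::'a)} = b"
    by (simp add: b_def card_cartesian_product card_Diff_singleton)
  then have b: "b \<in> nonzero_weights X"
    using weight_of_product [of "vec4 0 0 1 0"] ab by (simp add: nonzero_weights_def)
  have finite: "finite (nonzero_weights X)"
  proof (rule finite_subset)
    show "nonzero_weights X \<subseteq> {..card X}"
      by (auto simp: nonzero_weights_def weight_def intro!: card_mono)
  qed auto
  have low: "w = a \<or> b \<le> w" if w: "w \<in> nonzero_weights X" for w
  proof -
    obtain f where "f \<in> forms2" "w = weight X (codeword X f)" "w \<noteq> 0"
      using w by (auto simp: nonzero_weights_def functional_code_def)
    then show ?thesis
      using small_weights [OF q, of f] by (auto simp: a_def b_def)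
  qed
  have "Min (nonzero_weights X) = a"
    using finite a low ab by (intro Min_eqI) fastforce+
  moreover have "Min (nonzero_weights X - {a}) = b"
    using finite b low ab by (intro Min_eqI) auto
  ultimately show ?thesis
    by (simp add: second_weight_def b_def)
qed

lemma weight_eq_second_weight_iff:
  assumes "CARD('a) \<ge> 3"
  shows "weight X (codeword X f) = second_weight X \<longleftrightarrow> card {x \<in> X. form_eval f x = 0} = 3 * CARD('a) + 1"
proof -
  have "CARD('a) * (CARD('a) - 1) + (3 * CARD('a) + 1) = card X"
  proof -
    have "CARD('a) * (CARD('a) - 1) + CARD('a) = CARD('a) * CARD('a)"
      using assms by (simp add: diff_mult_distrib2)
    then show ?thesis
      by (simp add: card_X power2_eq_square)
  qed
  then show ?thesis
    using weight_plus_zeros [of X f] second_weight_X [OF assms] by linarith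
qed

lemma zeros_in_X: "{x \<in> X. form_eval f x = 0} = zero_set f \<inter> X"
  using X_eq by (auto simp: zero_set_def)

lemma many_zeros_planes:
  assumes q: "CARD('a) \<ge> 3" and f: "f \<in> forms2" and zeros: "card {x \<in> X. form_eval f x = 0} = 3 * CARD('a) + 1"
  obtains f' where "f' \<in> forms2" "f' \<noteq> 0" "codeword X f = codeword X f'"
    "tangent_planes_through_generator X (zero_set f') \<or> tangent_and_non_tangent_plane X (zero_set f')"
proof -
  let ?e = "vec4 1 0 0 0 :: 'a ^ 4"
  have "2 * CARD('a) + 2 < card {x \<in> X. form_eval f x = 0}"
    using zeros q by simp
  then obtain B B' m where B: "frame B B' X" "\<And>x. x \<in> X \<Longrightarrow> form_eval f x = (B *v x) $ 0 * dot m (B *v x)"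
    by (rule many_zeros_product [OF q f]) (rule that)
  interpret B: frame B B' X by (rule B(1))
  define f' where "f' = product_form (transpose B *v ?e) (transpose B *v m)"
  have f': "form_eval f' x = dot ?e (B *v x) * dot m (B *v x)" for x
    unfolding f'_def by (rule B.form_eval_product_frame)
  have same: "form_eval f x = form_eval f' x" if "x \<in> X" for x
    using B(2) [OF that] by (simp add: f' dot_first)
  \<comment> \<open>\<open>3q + 1\<close> is smaller than \<open>(q + 1)^2\<close>, so the form is
    not identically zero on \<open>X\<close>; this excludes \<open>m = 0\<close>.\<close>
  have "card {x \<in> X. form_eval f x = 0} \<noteq> card X"
    using zeros q by (simp add: card_X power2_eq_square)
  then obtain x where "x \<in> X" "form_eval f x \<noteq> 0"
    by (metis (mono_tags, lifting) Collect_cong Collect_mem_eq)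
  then have nz: "form_eval f' x \<noteq> 0"
    using same by simp
  then have "m \<noteq> 0"
    using f' by auto
  have "f' \<noteq> 0"
    using nz by (auto simp: form_eval_def)
  have code: "codeword X f = codeword X f'"
    unfolding codeword_def using same by (intro restrict_ext) auto
  define P where "P = {x \<in> points. dot ?e (B *v x) = 0}"
  define Q where "Q = {x \<in> points. dot m (B *v x) = 0}"
  have zero_set: "zero_set f' = P \<union> Q"
    by (auto simp: zero_set_def P_def Q_def f')
  \<comment> \<open>The plane \<open>y0 = 0\<close> is tangent in every frame, its coefficient
    vector having \<open>hyp\<close> zero.\<close>
  have P: "tangent_plane X P"
    unfolding P_def by (rule B.tangent_plane_dot) (auto simp: vec4_eq_iff hyp_def)
  have Q: "is_plane Q"
    unfolding Q_def by (rule B.is_plane_dot) fact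
  have planes: "is_plane P"
    using P by (simp add: tangent_plane_def)
  have "{x \<in> X. form_eval f x = 0} = {x \<in> X. form_eval f' x = 0}"
    using same by auto
  then have "card ((P \<union> Q) \<inter> X) = 3 * CARD('a) + 1"
    using zeros zeros_in_X zero_set by simp
  moreover have "card (P \<inter> X) + card (Q \<inter> X) = card (P \<inter> X \<union> Q \<inter> X) + card (P \<inter> X \<inter> (Q \<inter> X))"
    by (rule card_Un_Int) auto
  moreover have "P \<inter> X \<union> Q \<inter> X = (P \<union> Q) \<inter> X" "P \<inter> X \<inter> (Q \<inter> X) = P \<inter> Q \<inter> X"
    by auto
  \<comment> \<open>So \<open>Q\<close> has exactly \<open>q\<close> more points on \<open>X\<close>
    than the common line: a tangent plane, with \<open>2q + 1\<close>, leaves \<open>q + 1\<close>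
    on that line, a non-tangent one, with \<open>q + 1\<close>, leaves 1.\<close>
  ultimately have count: "2 * CARD('a) + 1 + card (Q \<inter> X) = 3 * CARD('a) + 1 + card (P \<inter> Q \<inter> X)"
    using card_tangent_plane_inter [OF P] by simp
  have "tangent_planes_through_generator X (zero_set f') \<or> tangent_and_non_tangent_plane X (zero_set f')"
  proof (cases "tangent_plane X Q")
    case True
    then have c: "card (P \<inter> Q \<inter> X) = CARD('a) + 1"
      using count card_tangent_plane_inter by fastforce
    then have "P \<noteq> Q"
      using card_tangent_plane_inter [OF P] q by auto
    then have line: "is_line (P \<inter> Q)"
      using planes_meet_in_line planes Q by blast
    then have "P \<inter> Q \<inter> X = P \<inter> Q"
      using c card_is_line [OF line] by (intro card_subset_eq) auto
    then have "generator X (P \<inter> Q)"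
      using line unfolding generator_def by blast
    then show ?thesis
      unfolding tangent_planes_through_generator_def using P True \<open>P \<noteq> Q\<close> zero_set by blast
  next
    case False
    then have Q': "non_tangent_plane X Q"
      using Q by (simp add: non_tangent_plane_def)
    then have c: "card (P \<inter> Q \<inter> X) = 1"
      using count card_non_tangent_plane_inter [OF Q'] by simp
    have "P \<noteq> Q"
      using P False by blast
    then have line: "is_line (P \<inter> Q)"
      using planes_meet_in_line planes Q by blast
    have "\<not> P \<inter> Q \<subseteq> X"
    proof
      assume "P \<inter> Q \<subseteq> X"
      then have "P \<inter> Q \<inter> X = P \<inter> Q"
        by blast
      then show False
        using c card_is_line [OF line] by simp
    qed
    then have "tangent_line X (P \<inter> Q)"
      using line c by (simp add: tangent_line_def)
    then show ?thesis
      unfolding tangent_and_non_tangent_plane_def using P Q' zero_set by blast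
  qed
  then show thesis
    using that [OF _ \<open>f' \<noteq> 0\<close> code] product_form_forms2 unfolding f'_def by blast
qed

text \<open>Inclusion-exclusion gives \<open>2(2q + 1) - (q + 1)\<close> for the first type and
  \<open>(2q + 1) + (q + 1) - 1\<close> for the second.\<close>

lemma card_inter_types_1_2:
  assumes "tangent_planes_through_generator X Y \<or> tangent_and_non_tangent_plane X Y"
  shows "card (Y \<inter> X) = 3 * CARD('a) + 1"
proof -
  have union: "card (P \<inter> X) + card (Q \<inter> X) = card ((P \<union> Q) \<inter> X) + card (P \<inter> Q \<inter> X)" for P Q
  proof -
    have "P \<inter> X \<union> Q \<inter> X = (P \<union> Q) \<inter> X" "P \<inter> X \<inter> (Q \<inter> X) = P \<inter> Q \<inter> X"
      by auto
    then show ?thesis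
      using card_Un_Int [of "P \<inter> X" "Q \<inter> X"] by simp
  qed
  show ?thesis
    using assms
  proof
    assume "tangent_planes_through_generator X Y"
    then obtain P Q where PQ: "tangent_plane X P" "tangent_plane X Q" "generator X (P \<inter> Q)" "Y = P \<union> Q"
      by (auto simp: tangent_planes_through_generator_def)
    have line: "is_line (P \<inter> Q)" "P \<inter> Q \<inter> X = P \<inter> Q"
      using PQ(3) by (auto simp: generator_def)
    then show ?thesis
      using union [of P Q] card_tangent_plane_inter [OF PQ(1)] card_tangent_plane_inter [OF PQ(2)]
        card_is_line [OF line(1)] PQ(4) by simp
  next
    assume "tangent_and_non_tangent_plane X Y"
    then obtain P Q where PQ: "tangent_plane X P" "non_tangent_plane X Q" "tangent_line X (P \<inter> Q)" "Y = P \<union> Q"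
      by (auto simp: tangent_and_non_tangent_plane_def)
    have "card (P \<inter> Q \<inter> X) = 1"
      using PQ(3) by (simp add: tangent_line_def)
    then show ?thesis
      using union [of P Q] card_tangent_plane_inter [OF PQ(1)] card_non_tangent_plane_inter [OF PQ(2)] PQ(4) by simp
  qed
qed

end

theorem theorem6p5:
  fixes X :: "('a::{field,finite} ^ 4) set"
  assumes "CARD('a) \<ge> 3"
    and "hyperbolic_quadric X"
  shows "\<forall>w \<in> functional_code X.
    weight X w = second_weight X \<longleftrightarrow>
    (\<exists>f \<in> forms2. f \<noteq> 0 \<and> w = codeword X f \<and>
       (tangent_planes_through_generator X (zero_set f) \<or>
        tangent_and_non_tangent_plane X (zero_set f) \<or>
        hyperbolic_sharing_two_generators X (zero_set f)))"
proof -
  obtain A A' where "frame A A' X"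
    by (rule hyperbolic_quadric_frame [OF assms(2)])
  then interpret frame A A' X .
  show ?thesis
  proof (intro ballI iffI)
    fix w assume "w \<in> functional_code X" and w: "weight X w = second_weight X"
    then obtain f where f: "f \<in> forms2" "w = codeword X f"
      by (auto simp: functional_code_def)
    then have "card {x \<in> X. form_eval f x = 0} = 3 * CARD('a) + 1"
      using w weight_eq_second_weight_iff [OF assms(1)] by simp
    then obtain f' where "f' \<in> forms2" "f' \<noteq> 0" "codeword X f = codeword X f'"
      "tangent_planes_through_generator X (zero_set f') \<or> tangent_and_non_tangent_plane X (zero_set f')"
      by (rule many_zeros_planes [OF assms(1) f(1)])
    then show "\<exists>f\<in>forms2. f \<noteq> 0 \<and> w = codeword X f \<and>
       (tangent_planes_through_generator X (zero_set f) \<or>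
        tangent_and_non_tangent_plane X (zero_set f) \<or>
        hyperbolic_sharing_two_generators X (zero_set f))"
      using f(2) by blast
  next
    fix w assume "\<exists>f\<in>forms2. f \<noteq> 0 \<and> w = codeword X f \<and>
       (tangent_planes_through_generator X (zero_set f) \<or>
        tangent_and_non_tangent_plane X (zero_set f) \<or>
        hyperbolic_sharing_two_generators X (zero_set f))"
    then obtain f where f: "w = codeword X f"
      "tangent_planes_through_generator X (zero_set f) \<or>
        tangent_and_non_tangent_plane X (zero_set f) \<or>
        hyperbolic_sharing_two_generators X (zero_set f)"
      by blast
    then have "card (zero_set f \<inter> X) = 3 * CARD('a) + 1"
      using card_inter_types_1_2 card_inter_sharing_two_generators [OF assms(2)] by (metis Int_commute)
    then show "weight X w = second_weight X"
      using f(1) weight_eq_second_weight_iff [OF assms(1)] zeros_in_X by simp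
  qed
qed

end
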